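(* Let $\mathbb F=\mathbb R$ and $\mu>\rho-1$. Then the group $\mathrm{Aut}(X_{q,\mu})$ of all hypergroup automorphisms of $X_{q,\mu}$ is exactly $\{T_a:\ a\in GL(q,\mathbb R)\}$.
   Context: Let $\mathbb F\in\{\mathbb R,\mathbb C,\mathbb H\}$ with real dimension $d\in\{1,2,4\}$ and fix $q\in\mathbb N$. $M_q$ denotes the $q\times q$ matrices over $\mathbb F$, $x^*=\bar x^t$, $H_q=\{x\in M_q:x=x^*\}$ with the real scalar product $(x|y)=\mathrm{Re}\,\mathrm{tr}(x^*y)$ and norm $\|x\|=(x|x)^{1/2}$; $\Pi_q\subset H_q$ is the cone of positive semidefinite matrices, $\Omega_q$ its interior (positive definite matrices), $U_q$ the unitary group, $GL(q)=GL(q,\mathbb F)$. For $r\in\Pi_q$, $\sqrt r$ is its unique positive semidefinite square root. $\Delta$ is the determinant function of the symmetric cone $\Omega_q$ (the usual determinant for $\mathbb F=\mathbb R,\mathbb C$). Put $\rho=d(q-\frac12)+1$. For $\mu>\rho-1$ let $D=\{v\in M_q: v^*v<I\}$, $\kappa_\mu=\int_D\Delta(I-v^*v)^{\mu-\rho}dv$ (Lebesgue measure on $M_q\cong\mathbb R^{dq^2}$). The matrix Bessel hypergroup $X_{q,\mu}=(\Pi_q,*_\mu)$ is $\Pi_q$ with the convolution of bounded Borel measures obtained by bilinear, weakly continuous extension of $(\delta_r*_\mu\delta_s)(f)=\kappa_\mu^{-1}\int_D f\big(\sqrt{r^2+s^2+svr+rv^*s}\big)\Delta(I-vv^* )^{\mu-\rho}dv$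 ($f\in C_c(\Pi_q)$). It is a commutative hypergroup with neutral element $0$ and identity involution. A hypergroup automorphism of $X_{q,\mu}$ is a homeomorphism $T:\Pi_q\to\Pi_q$ with $T(\delta_x*_\mu\delta_y)=\delta_{T(x)}*_\mu\delta_{T(y)}$ for all $x,y$ (image measures). For $a\in M_q$ define $T_a:\Pi_q\to\Pi_q$, $T_a(r)=\sqrt{ar^2a^*}$. *)

theory Defs
  imports "HOL-Analysis.Analysis"
begin

text \<open>Case F = R: M_q = real^'n^'n with q = CARD('n), x* = transpose x.\<close>

definition psd :: "(real^'n^'n) set" where
  "psd = {A. transpose A = A \<and> (\<forall>x. 0 \<le> x \<bullet> (A *v x))}"

definition pd_mat :: "real^'n^'n \<Rightarrow> bool" where
  "pd_mat A \<longleftrightarrow> transpose A = A \<and> (\<forall>x. x \<noteq> 0 \<longrightarrow> 0 < x \<bullet> (A *v x))"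

definition ballD :: "(real^'n^'n) set" where
  "ballD = {v. pd_mat (mat 1 - transpose v ** v)}"

definition msqrt :: "real^'n^'n \<Rightarrow> real^'n^'n" where
  "msqrt r = (THE s. s \<in> psd \<and> s ** s = r)"

text \<open>rho = d(q - 1/2) + 1 with d = 1\<close>
definition rho_of :: "('n::finite) itself \<Rightarrow> real" where
  "rho_of _ = real CARD('n) - 1/2 + 1"

definition kappa :: "real \<Rightarrow> ('n::finite) itself \<Rightarrow> real" where
  "kappa \<mu> _ = (LINT v:(ballD::(real^'n^'n) set)|lborel.
      det (mat 1 - transpose v ** v) powr (\<mu> - rho_of TYPE('n)))"

definition base_measure :: "real \<Rightarrow> (real^'n^'n) measure" where
  "base_measure \<mu> = density (restrict_space lborel ballD)
     (\<lambda>v. ennreal (det (mat 1 - v ** transpose v) powr (\<mu> - rho_of TYPE('n)) / kappa \<mu> TYPE('n)))"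

text \<open>delta_r *_mu delta_s as a measure on Pi_q (Borel sets)\<close>
definition bconv :: "real \<Rightarrow> real^'n^'n \<Rightarrow> real^'n^'n \<Rightarrow> (real^'n^'n) measure" where
  "bconv \<mu> r s = distr (base_measure \<mu>) (restrict_space borel psd)
     (\<lambda>v. msqrt (r ** r + s ** s + s ** v ** r + r ** transpose v ** s))"

definition T_a :: "real^'n^'n \<Rightarrow> real^'n^'n \<Rightarrow> real^'n^'n" where
  "T_a a r = msqrt (a ** r ** r ** transpose a)"

definition hyp_aut :: "real \<Rightarrow> (real^'n^'n \<Rightarrow> real^'n^'n) \<Rightarrow> bool" where
  "hyp_aut \<mu> T \<longleftrightarrow> (\<exists>T'. homeomorphism psd psd T T') \<and>
     (\<forall>x\<in>psd. \<forall>y\<in>psd. distr (bconv \<mu> x y) (restrict_space borel psd) T = bconv \<mu> (T x) (T y))"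

end

theory Submission
  imports Defs
begin

text \<open>
  In the squared coordinates \<open>R = r\<^sup>2\<close> the support of \<open>\<delta>\<^sub>r * \<delta>\<^sub>s\<close> is the set of all
  \<open>R + S + s v r + r v\<^sup>T s\<close> with \<open>v\<close> a contraction, and an automorphism maps supports to supports.
  For \<open>R = S\<close> the support is the order interval \<open>[0, 4R]\<close>, so the automorphism preserves the Loewner
  order, hence also the rank-one matrices, which are those whose lower set is a chain. For
  \<open>R = x x\<^sup>T\<close> and \<open>S = y y\<^sup>T\<close> the support is the segment with endpoints \<open>(x \<plusminus> y)(x \<plusminus> y)\<^sup>T\<close>; a
  homeomorphism maps endpoints to endpoints, so the image of \<open>x x\<^sup>T\<close> satisfies the parallelogram law
  in \<open>x\<close> and is \<open>(a x)(a x)\<^sup>T\<close> for a linear \<open>a\<close>. A positive semidefinite matrix is determined by the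
  rank-one matrices below it, so the automorphism is \<open>R \<mapsto> a R a\<^sup>T\<close> everywhere.

  Conversely, the polar decomposition \<open>a r = \<surd>(a r\<^sup>2 a\<^sup>T) u\<close> reduces the automorphism property of such a map to the
  invariance of the weight on the matrix ball under \<open>v \<mapsto> w v u\<^sup>T\<close> with \<open>u\<close>, \<open>w\<close> orthogonal. That the
  normalizing constant is finite and positive in the full range \<open>\<mu> > \<rho> - 1\<close> follows by integrating out
  the rows of \<open>v\<close> one at a time.
\<close>

text \<open>Passing to supports discards the weight, so \<mu> and \<open>kappa\<close> enter the
  forward direction only through positivity of the density on the ball. That positivity has to be
  earned: \<open>kappa\<close> is a Bochner integral, equal to 0 if the integrand is not integrable,
  and dividing by it would then give the zero measure with empty support. Hence integrability is
  proved for every exponent above -1, including the negative ones, where the weight is unbounded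
  near the boundary. Three obstacles shape the algebra. The supports only compare A with 4 B, and F
  (4 B) = 4 F B is not known in advance, so the order has to be expressed through that relation
  alone. The matrix x x^T knows x only up to sign, so arbitrarily chosen image vectors need not be
  additive; polarising against one fixed vector selects coherent signs. Finally, factoring through a
  square root calls for an inverse, which singular matrices lack; the factors are found after adding
  I/(k+1) and passed to the limit by compactness.\<close>

declare transpose_matrix_vector [simp del] vector_transpose_matrix [simp del]

section \<open>Real matrices\<close>

lemma inner_matrix_vector_left: "(A *v x) \<bullet> y = x \<bullet> (transpose A *v y)"
  for A :: "real^'n^'m"
  by (metis dot_lmul_matrix inner_commute transpose_matrix_vector)

lemma inner_matrix_vector_symmetric: "transpose A = A \<Longrightarrow> (A *v x) \<bullet> y = x \<bullet> (A *v y)"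
  for A :: "real^'n^'n"
  by (metis inner_matrix_vector_left)

lemma matrix_eqI: "(\<And>x. A *v x = B *v x) \<Longrightarrow> A = B"
  for A B :: "real^'n^'m"
  by (simp add: matrix_eq)

lemma transpose_add: "transpose (A + B) = transpose A + transpose B"
  by (simp add: transpose_def vec_eq_iff)

lemma transpose_diff: "transpose (A - B) = transpose A - transpose B"
  by (simp add: transpose_def vec_eq_iff)

lemma transpose_zero [simp]: "transpose 0 = 0"
  by (simp add: transpose_def vec_eq_iff)

lemma matrix_add_rdistrib: "(A + B) ** C = A ** C + B ** C"
  for A :: "real^'n^'m"
  by (rule matrix_eqI) (simp add: matrix_vector_mul_assoc[symmetric] algebra_simps)

lemma matrix_sub_ldistrib: "A ** (B - C) = A ** B - A ** C"
  for A :: "real^'n^'m"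
  by (rule matrix_eqI) (simp add: matrix_vector_mul_assoc[symmetric] algebra_simps)

lemma matrix_sub_rdistrib: "(A - B) ** C = A ** C - B ** C"
  for A :: "real^'n^'m"
  by (rule matrix_eqI) (simp add: matrix_vector_mul_assoc[symmetric] algebra_simps)

lemma matrix_mult_zero_left [simp]: "0 ** A = 0" for A :: "real^'n^'m"
  by (rule matrix_eqI) (simp add: matrix_vector_mul_assoc[symmetric])

lemma matrix_mult_zero_right [simp]: "A ** 0 = 0" for A :: "real^'n^'m"
  by (rule matrix_eqI) (simp add: matrix_vector_mul_assoc[symmetric])

lemma scaleR_matrix_vector: "(c *\<^sub>R A) *v x = c *\<^sub>R (A *v x)"
  for A :: "real^'n^'m"
  by (simp add: scaleR_matrix_vector_assoc)

lemma bounded_bilinear_matrix_mult: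
  "bounded_bilinear ((**) :: real^'n^'m \<Rightarrow> real^'p^'n \<Rightarrow> real^'p^'m)"
  unfolding bilinear_conv_bounded_bilinear[symmetric] bilinear_def
  by (auto intro!: linearI simp: matrix_add_ldistrib matrix_add_rdistrib matrix_eq
      matrix_vector_mul_assoc[symmetric] scaleR_matrix_vector algebra_simps)

lemma bounded_bilinear_matrix_vector_mult:
  "bounded_bilinear ((*v) :: real^'n^'m \<Rightarrow> real^'n \<Rightarrow> real^'m)"
  unfolding bilinear_conv_bounded_bilinear[symmetric] bilinear_def
  by (auto intro!: linearI simp: scaleR_matrix_vector algebra_simps)

lemma bounded_linear_transpose: "bounded_linear (transpose :: real^'n^'m \<Rightarrow> real^'m^'n)"
  unfolding linear_conv_bounded_linear[symmetric]
  by (auto intro!: linearI simp: transpose_add transpose_scalar)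

lemmas continuous_on_matrix_mult [continuous_intros] =
  bounded_bilinear.continuous_on[OF bounded_bilinear_matrix_mult]
lemmas continuous_on_matrix_vector_mult [continuous_intros] =
  bounded_bilinear.continuous_on[OF bounded_bilinear_matrix_vector_mult]
lemmas continuous_on_transpose [continuous_intros] =
  bounded_linear.continuous_on[OF bounded_linear_transpose]
lemmas tendsto_matrix_mult [tendsto_intros] =
  bounded_bilinear.tendsto[OF bounded_bilinear_matrix_mult]
lemmas tendsto_transpose [tendsto_intros] =
  bounded_linear.tendsto[OF bounded_linear_transpose]
lemmas scaleR_matrix_mult_left = bounded_bilinear.scaleR_left[OF bounded_bilinear_matrix_mult]
lemmas scaleR_matrix_mult_right = bounded_bilinear.scaleR_right[OF bounded_bilinear_matrix_mult]

text \<open>The norm on nested vectors is the Frobenius norm; Cauchy-Schwarz in each row shows that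
  it dominates the operator norm.\<close>

lemma norm_matrix_vector_le: "norm (A *v x) \<le> norm A * norm x"
  for A :: "real^'n^'m"
proof -
  have "(norm (A *v x))\<^sup>2 = (\<Sum>i\<in>UNIV. (A $ i \<bullet> x)\<^sup>2)"
    unfolding power2_norm_eq_inner by (simp add: inner_vec_def matrix_vector_mul_component power2_eq_square)
  also have "\<dots> \<le> (\<Sum>i\<in>UNIV. (norm (A $ i))\<^sup>2 * (norm x)\<^sup>2)"
    by (rule sum_mono) (metis Cauchy_Schwarz_ineq power2_norm_eq_inner)
  also have "\<dots> = (norm A * norm x)\<^sup>2"
    unfolding power_mult_distrib power2_norm_eq_inner[of A]
    by (simp add: inner_vec_def[of A] power2_norm_eq_inner sum_distrib_right)
  finally show ?thesis
    by (rule power2_le_imp_le) simp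
qed

section \<open>Rank-one matrices\<close>

definition outer :: "real^'m \<Rightarrow> real^'n \<Rightarrow> real^'n^'m" where
  "outer x y = (\<chi> i j. x $ i * y $ j)"

lemma outer_vector_mult: "outer x y *v z = (y \<bullet> z) *\<^sub>R x"
  by (simp add: outer_def matrix_vector_mult_def vec_eq_iff inner_vec_def sum_distrib_left
      mult_ac)

lemma transpose_outer: "transpose (outer x y) = outer y x"
  by (simp add: outer_def transpose_def vec_eq_iff mult.commute)

lemma bounded_bilinear_outer: "bounded_bilinear (outer :: real^'m \<Rightarrow> real^'n \<Rightarrow> real^'n^'m)"
  unfolding bilinear_conv_bounded_bilinear[symmetric] bilinear_def
  by (auto intro!: linearI simp: outer_def vec_eq_iff algebra_simps)

lemmas outer_add_left = bounded_bilinear.add_left[OF bounded_bilinear_outer]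
lemmas outer_add_right = bounded_bilinear.add_right[OF bounded_bilinear_outer]
lemmas outer_diff_left = bounded_bilinear.diff_left[OF bounded_bilinear_outer]
lemmas outer_diff_right = bounded_bilinear.diff_right[OF bounded_bilinear_outer]
lemmas outer_scaleR_left = bounded_bilinear.scaleR_left[OF bounded_bilinear_outer]
lemmas outer_zero_left [simp] = bounded_bilinear.zero_left[OF bounded_bilinear_outer]
lemmas outer_zero_right [simp] = bounded_bilinear.zero_right[OF bounded_bilinear_outer]
lemmas outer_minus_left = bounded_bilinear.minus_left[OF bounded_bilinear_outer]
lemmas outer_minus_right = bounded_bilinear.minus_right[OF bounded_bilinear_outer]
lemmas continuous_on_outer [continuous_intros] =
  bounded_bilinear.continuous_on[OF bounded_bilinear_outer]

lemma matrix_mult_outer: "A ** outer x y = outer (A *v x) y"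
  by (rule matrix_eqI)
    (simp add: matrix_vector_mul_assoc[symmetric] outer_vector_mult matrix_vector_mult_scaleR)

lemma outer_matrix_mult: "outer x y ** A = outer x (transpose A *v y)"
  by (rule matrix_eqI)
    (simp add: matrix_vector_mul_assoc[symmetric] outer_vector_mult inner_matrix_vector_left)

lemma outer_eq_0_iff: "outer x x = 0 \<longleftrightarrow> x = 0"
proof
  assume "outer x x = 0"
  then have "(x \<bullet> x) *\<^sub>R x = 0"
    by (metis outer_vector_mult matrix_vector_mult_0)
  then show "x = 0" by auto
qed simp

section \<open>Positive semidefinite matrices\<close>

lemma psdI: "transpose A = A \<Longrightarrow> (\<And>x. 0 \<le> x \<bullet> (A *v x)) \<Longrightarrow> A \<in> psd"
  by (simp add: psd_def)

lemma psd_symmetric: "A \<in> psd \<Longrightarrow> transpose A = A"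
  by (simp add: psd_def)

lemma psd_nonneg: "A \<in> psd \<Longrightarrow> 0 \<le> x \<bullet> (A *v x)"
  by (simp add: psd_def)

lemma psd_zero [simp]: "0 \<in> psd"
  by (simp add: psd_def)

lemma psd_mat_1 [simp]: "mat 1 \<in> psd"
  by (simp add: psd_def)

lemma psd_add: "A \<in> psd \<Longrightarrow> B \<in> psd \<Longrightarrow> A + B \<in> psd"
  by (simp add: psd_def transpose_add algebra_simps inner_add_right)

lemma psd_scaleR: "A \<in> psd \<Longrightarrow> 0 \<le> c \<Longrightarrow> c *\<^sub>R A \<in> psd"
  by (simp add: psd_def transpose_scalar scaleR_matrix_vector)

lemma psd_outer: "outer x x \<in> psd"
  by (simp add: psd_def transpose_outer outer_vector_mult inner_commute)

lemma psd_congruence: "A \<in> psd \<Longrightarrow> B ** A ** transpose B \<in> psd"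
  for A :: "real^'n^'n" and B :: "real^'n^'n"
  by (auto simp: psd_def matrix_transpose_mul matrix_mul_assoc matrix_vector_mul_assoc[symmetric]
      inner_matrix_vector_left[symmetric])
    (metis inner_matrix_vector_left transpose_transpose)

lemma psd_square: "A \<in> psd \<Longrightarrow> A ** A \<in> psd"
  using psd_congruence[of "mat 1" A] by (simp add: psd_symmetric)

lemma psd_Cauchy_Schwarz:
  assumes "A \<in> psd"
  shows "(x \<bullet> (A *v y))\<^sup>2 \<le> (x \<bullet> (A *v x)) * (y \<bullet> (A *v y))"
proof -
  define a b c where "a = x \<bullet> (A *v x)" and "b = x \<bullet> (A *v y)" and "c = y \<bullet> (A *v y)"
  have sym: "y \<bullet> (A *v x) = b"
    unfolding b_def using assms by (metis inner_commute inner_matrix_vector_symmetric psd_symmetric)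
  have q: "0 \<le> a + 2 * t * b + t\<^sup>2 * c" for t
    using psd_nonneg[OF assms, of "x + t *\<^sub>R y"] sym
    by (simp add: algebra_simps inner_add_left inner_add_right a_def[symmetric] b_def[symmetric]
        c_def[symmetric] power2_eq_square)
  have "0 \<le> c" unfolding c_def by (rule psd_nonneg[OF assms])
  have "b\<^sup>2 \<le> a * c"
  proof (cases "c = 0")
    case True
    have "b = 0"
    proof (rule ccontr)
      assume "b \<noteq> 0"
      \<comment> \<open>With c = 0 the form is affine in t, and this t gives it the value a - (a +
        1) = -1.\<close>
      then show False using q[of "- (a + 1) / (2 * b)"] True by (simp add: field_simps)
    qed
    then show ?thesis using True by simp
  next
    case False
    then have "c > 0" using \<open>0 \<le> c\<close> by simp
    \<comment> \<open>t = -b/c minimises the quadratic polynomial.\<close>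
    have "0 \<le> a - b\<^sup>2 / c"
      using q[of "- b / c"] \<open>c > 0\<close> by (simp add: field_simps power2_eq_square)
    then show ?thesis using \<open>c > 0\<close> by (simp add: field_simps)
  qed
  then show ?thesis by (simp add: a_def b_def c_def)
qed

text \<open>Cauchy-Schwarz for the form of A, applied to the pair A x and x, bounds the fourth power
  of the norm of A x by a multiple of x . A x = 0.\<close>

lemma psd_kernel:
  assumes "A \<in> psd" "x \<bullet> (A *v x) = 0"
  shows "A *v x = 0"
proof -
  have "((A *v x) \<bullet> (A *v x))\<^sup>2 \<le> 0"
    using psd_Cauchy_Schwarz[OF assms(1), of "A *v x" x] assms(2) by simp
  then show ?thesis by simp
qed

lemma symmetric_form_zero:
  fixes A :: "real^'n^'n"
  assumes "transpose A = A" "\<And>x. x \<bullet> (A *v x) = 0"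
  shows "A = 0"
  using psd_kernel[of A] assms by (intro matrix_eqI) (simp add: psdI)

text \<open>A maximiser e of |x . A x| on the unit sphere makes \<open>l I - A\<close> or
  \<open>A - l I\<close> positive semidefinite, depending on the sign of the extremal value l, with
  e isotropic for it; \<open>psd_kernel\<close> then yields the eigenvector equation without
  differentiating.\<close>

lemma symmetric_extremal_eigenvector:
  fixes A :: "real^'n^'n"
  assumes sym: "transpose A = A"
  obtains l e where "norm e = 1" "A *v e = l *\<^sub>R e" "\<And>x. \<bar>x \<bullet> (A *v x)\<bar> \<le> \<bar>l\<bar> * (x \<bullet> x)"
proof -
  obtain k :: 'n where True by simp
  have ne: "sphere (0::real^'n) 1 \<noteq> {}"
    using norm_axis_1[of k] by (metis empty_iff mem_sphere_0)
  obtain e where e: "norm e = 1" and max: "\<And>x. norm x = 1 \<Longrightarrow> \<bar>x \<bullet> (A *v x)\<bar> \<le> \<bar>e \<bullet> (A *v e)\<bar>"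
    using continuous_attains_sup[OF compact_sphere ne, of "\<lambda>x. \<bar>x \<bullet> (A *v x)\<bar>"]
    by (force intro!: continuous_intros)
  define l where "l = e \<bullet> (A *v e)"
  have bound: "\<bar>x \<bullet> (A *v x)\<bar> \<le> \<bar>l\<bar> * (x \<bullet> x)" for x
  proof (cases "x = 0")
    case False
    define c where "c = norm x"
    have c: "c > 0" using False by (simp add: c_def)
    define y where "y = x /\<^sub>R c"
    have x: "x = c *\<^sub>R y" using c by (simp add: y_def)
    have y: "norm y = 1" using c by (simp add: y_def c_def)
    have "y \<bullet> y = 1" using y by (simp add: norm_eq_1)
    then show ?thesis
      using max[OF y] c
      unfolding x l_def by (simp add: matrix_vector_mult_scaleR abs_mult mult_left_mono)
  qed simp
  have ee: "e \<bullet> e = 1" using e by (simp add: norm_eq_1)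
  have "A *v e = l *\<^sub>R e"
  proof (cases "l \<ge> 0")
    case True
    have "l *\<^sub>R mat 1 - A \<in> psd"
    proof (rule psdI)
      show "transpose (l *\<^sub>R mat 1 - A) = l *\<^sub>R mat 1 - A"
        using sym by (simp add: transpose_diff transpose_scalar)
      show "0 \<le> x \<bullet> ((l *\<^sub>R mat 1 - A) *v x)" for x
        using bound[of x] True
        by (simp add: matrix_vector_mult_diff_rdistrib scaleR_matrix_vector inner_diff_right)
    qed
    then have "(l *\<^sub>R mat 1 - A) *v e = 0"
      by (rule psd_kernel)
        (simp add: matrix_vector_mult_diff_rdistrib scaleR_matrix_vector inner_diff_right l_def ee)
    then show ?thesis by (simp add: matrix_vector_mult_diff_rdistrib scaleR_matrix_vector)
  next
    case False
    have "A - l *\<^sub>R mat 1 \<in> psd"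
    proof (rule psdI)
      show "transpose (A - l *\<^sub>R mat 1) = A - l *\<^sub>R mat 1"
        using sym by (simp add: transpose_diff transpose_scalar)
      show "0 \<le> x \<bullet> ((A - l *\<^sub>R mat 1) *v x)" for x
        using bound[of x] False
        by (simp add: matrix_vector_mult_diff_rdistrib scaleR_matrix_vector inner_diff_right)
    qed
    then have "(A - l *\<^sub>R mat 1) *v e = 0"
      by (rule psd_kernel)
        (simp add: matrix_vector_mult_diff_rdistrib scaleR_matrix_vector inner_diff_right l_def ee)
    then show ?thesis by (simp add: matrix_vector_mult_diff_rdistrib scaleR_matrix_vector)
  qed
  then show thesis using that e bound by blast
qed

text \<open>Deflation: subtracting the extremal eigenprojection enlarges the kernel.\<close>

lemma psd_sqrt_exists:
  fixes A :: "real^'n^'n"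
  assumes "A \<in> psd"
  shows "\<exists>s\<in>psd. s ** s = A"
  using assms
proof (induction "DIM(real^'n) - dim {x. A *v x = 0}" arbitrary: A rule: less_induct)
  case less
  show ?case
  proof (cases "A = 0")
    case True
    then show ?thesis by (intro bexI[of _ 0]) simp_all
  next
    case False
    note sym = psd_symmetric[OF \<open>A \<in> psd\<close>]
    obtain l e where e: "norm e = 1" and Ae: "A *v e = l *\<^sub>R e"
      and bound: "\<And>x. \<bar>x \<bullet> (A *v x)\<bar> \<le> \<bar>l\<bar> * (x \<bullet> x)"
      using symmetric_extremal_eigenvector[OF sym] by blast
    have ee: "e \<bullet> e = 1" using e by (simp add: norm_eq_1)
    have "l \<noteq> 0"
    proof
      assume "l = 0"
      then have "x \<bullet> (A *v x) = 0" for x using bound[of x] by simp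
      then show False using symmetric_form_zero[OF sym] False by blast
    qed
    moreover have "0 \<le> l" using psd_nonneg[OF \<open>A \<in> psd\<close>, of e] Ae ee by simp
    ultimately have l: "l > 0" by simp
    have eA: "e \<bullet> (A *v x) = l * (e \<bullet> x)" for x
      using inner_matrix_vector_symmetric[OF sym, of e x] Ae by simp
    define B where "B = A - l *\<^sub>R outer e e"
    have Bx: "B *v x = A *v x - (l * (e \<bullet> x)) *\<^sub>R e" for x
      by (simp add: B_def matrix_vector_mult_diff_rdistrib scaleR_matrix_vector outer_vector_mult)
    have "B \<in> psd"
    proof (rule psdI)
      show "transpose B = B" by (simp add: B_def transpose_diff transpose_scalar transpose_outer sym)
      fix x
      \<comment> \<open>The form of B at x is the form of A at the component of x orthogonal to
        e.\<close>
      have "0 \<le> (x - (e \<bullet> x) *\<^sub>R e) \<bullet> (A *v (x - (e \<bullet> x) *\<^sub>R e))"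
        by (rule psd_nonneg[OF \<open>A \<in> psd\<close>])
      also have "\<dots> = x \<bullet> (B *v x)"
        by (simp add: Bx matrix_vector_mult_diff_distrib matrix_vector_mult_scaleR Ae inner_diff_left
            inner_diff_right eA ee inner_commute algebra_simps)
      finally show "0 \<le> x \<bullet> (B *v x)" .
    qed
    have Be: "B *v e = 0" by (simp add: Bx Ae ee)
    have "{x. A *v x = 0} \<subset> {x. B *v x = 0}"
    proof
      show "{x. A *v x = 0} \<subseteq> {x. B *v x = 0}"
      proof clarify
        fix x assume "A *v x = 0"
        then show "B *v x = 0" using eA[of x] by (simp add: Bx)
      qed
      show "{x. A *v x = 0} \<noteq> {x. B *v x = 0}"
      proof
        assume "{x. A *v x = 0} = {x. B *v x = 0}"
        then have "A *v e = 0" using Be by blast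
        then show False using Ae l e by auto
      qed
    qed
    moreover have sub: "subspace {x. M *v x = 0}" for M :: "real^'n^'n"
      by (auto simp: subspace_def matrix_vector_right_distrib matrix_vector_mult_scaleR)
    ultimately have "dim {x. A *v x = 0} < dim {x. B *v x = 0}"
      by (intro dim_psubset) (simp add: span_eq_iff[THEN iffD2, OF sub])
    moreover have "dim {x. B *v x = 0} \<le> DIM(real^'n)" by (rule dim_subset_UNIV)
    ultimately have "DIM(real^'n) - dim {x. B *v x = 0} < DIM(real^'n) - dim {x. A *v x = 0}"
      by linarith
    then obtain s where s: "s \<in> psd" "s ** s = B" using less.hyps \<open>B \<in> psd\<close> by blast
    \<comment> \<open>The root s of B also kills e, so the cross terms vanish when s plus a multiple
      of e e^T is squared.\<close>
    have "(s *v e) \<bullet> (s *v e) = e \<bullet> (B *v e)"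
      using s by (simp add: inner_matrix_vector_symmetric psd_symmetric matrix_vector_mul_assoc)
    then have se: "s *v e = 0" using Be by simp
    have es: "e \<bullet> (s *v x) = 0" for x
      using inner_matrix_vector_symmetric[OF psd_symmetric[OF s(1)], of e x] se by simp
    let ?t = "s + sqrt l *\<^sub>R outer e e"
    have "?t \<in> psd" using s(1) l by (intro psd_add psd_scaleR psd_outer) auto
    moreover have "?t ** ?t = A"
    proof (rule matrix_eqI)
      fix x
      have "(?t ** ?t) *v x = (s ** s) *v x + (l * (e \<bullet> x)) *\<^sub>R e"
        using l by (simp add: matrix_vector_mul_assoc[symmetric] matrix_vector_mult_add_rdistrib
          scaleR_matrix_vector outer_vector_mult matrix_vector_right_distrib
          matrix_vector_mult_scaleR se es inner_add_right ee)
      then show "(?t ** ?t) *v x = A *v x" using s(2) Bx by simp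
    qed
    ultimately show ?thesis by blast
  qed
qed

text \<open>Let l be the extremal eigenvalue of s - t, with unit eigenvector e, and let a, b \<ge> 0
  be the values of the forms of s and t at e. Then a - b = l, and the form of s^2 - t^2 at e is l (a
  + b). As |l| \<le> a + b, this bounds l^2 by the norm of s^2 - t^2. The estimate yields both
  uniqueness and continuity of square roots.\<close>

lemma psd_sqrt_distance:
  fixes s t :: "real^'n^'n"
  assumes "s \<in> psd" "t \<in> psd"
  shows "\<bar>x \<bullet> ((s - t) *v x)\<bar> \<le> sqrt (norm (s ** s - t ** t)) * (x \<bullet> x)"
proof -
  let ?d = "s - t"
  have sym: "transpose ?d = ?d" using assms by (simp add: transpose_diff psd_symmetric)
  obtain l e where e: "norm e = 1" and de: "?d *v e = l *\<^sub>R e"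
    and bound: "\<And>x. \<bar>x \<bullet> (?d *v x)\<bar> \<le> \<bar>l\<bar> * (x \<bullet> x)"
    using symmetric_extremal_eigenvector[OF sym] by blast
  have ee: "e \<bullet> e = 1" using e by (simp add: norm_eq_1)
  define a b where "a = e \<bullet> (s *v e)" and "b = e \<bullet> (t *v e)"
  have ab: "0 \<le> a" "0 \<le> b" unfolding a_def b_def using assms by (auto intro: psd_nonneg)
  have ste: "s *v e = t *v e + l *\<^sub>R e" using de by (simp add: algebra_simps)
  then have l: "a = b + l" by (simp add: a_def b_def inner_add_right ee)
  have "e \<bullet> ((s ** s - t ** t) *v e) = (s *v e) \<bullet> (s *v e) - (t *v e) \<bullet> (t *v e)"
    using assms by (simp add: matrix_vector_mult_diff_rdistrib inner_diff_right
        matrix_vector_mul_assoc[symmetric] inner_matrix_vector_symmetric psd_symmetric)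
  also have "\<dots> = l * (a + b)"
    unfolding l unfolding ste by (simp add: inner_add_left inner_add_right ee b_def inner_commute algebra_simps)
  finally have "l * (a + b) = e \<bullet> ((s ** s - t ** t) *v e)" ..
  also have "\<bar>\<dots>\<bar> \<le> norm e * (norm (s ** s - t ** t) * norm e)"
    by (rule order_trans[OF Cauchy_Schwarz_ineq2]) (intro mult_left_mono norm_matrix_vector_le norm_ge_zero)
  finally have "\<bar>l\<bar> * (a + b) \<le> norm (s ** s - t ** t)" using e ab by (simp add: abs_mult)
  moreover have "l\<^sup>2 \<le> \<bar>l\<bar> * (a + b)"
  proof -
    have "\<bar>l\<bar> \<le> a + b" using l ab by auto
    then have "\<bar>l\<bar> * \<bar>l\<bar> \<le> \<bar>l\<bar> * (a + b)" by (intro mult_left_mono) auto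
    then show ?thesis by (simp add: power2_eq_square)
  qed
  ultimately have "\<bar>l\<bar> \<le> sqrt (norm (s ** s - t ** t))"
    by (intro real_le_rsqrt) simp
  then show ?thesis
    using bound[of x] by (meson inner_ge_zero mult_right_mono order_trans)
qed

lemma psd_sqrt_unique:
  assumes "s \<in> psd" "t \<in> psd" "s ** s = t ** t"
  shows "s = t"
proof -
  have "x \<bullet> ((s - t) *v x) = 0" for x
    using psd_sqrt_distance[OF assms(1,2), of x] assms(3) by simp
  then have "s - t = 0"
    using assms by (intro symmetric_form_zero) (simp_all add: transpose_diff psd_symmetric)
  then show ?thesis by simp
qed

lemma
  assumes "A \<in> psd"
  shows msqrt_psd: "msqrt A \<in> psd"
    and msqrt_square: "msqrt A ** msqrt A = A"
proof -
  have "\<exists>!s. s \<in> psd \<and> s ** s = A"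
    using psd_sqrt_exists[OF assms] psd_sqrt_unique by blast
  then have "msqrt A \<in> psd \<and> msqrt A ** msqrt A = A"
    unfolding msqrt_def by (rule theI')
  then show "msqrt A \<in> psd" "msqrt A ** msqrt A = A" by auto
qed

lemma msqrt_eqI: "s \<in> psd \<Longrightarrow> s ** s = A \<Longrightarrow> msqrt A = s"
  using psd_sqrt_unique msqrt_psd msqrt_square psd_square by metis

lemma msqrt_of_square: "s \<in> psd \<Longrightarrow> msqrt (s ** s) = s"
  by (rule msqrt_eqI) auto

text \<open>Polarisation: for symmetric w the bilinear form is a difference of two values of the
  quadratic form, and the parallelogram law controls their sum.\<close>

lemma symmetric_norm_bound:
  fixes w :: "real^'n^'n"
  assumes sym: "transpose w = w" and bound: "\<And>x. \<bar>x \<bullet> (w *v x)\<bar> \<le> c * (x \<bullet> x)"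
  shows "norm (w *v y) \<le> c * norm y"
proof (cases "w *v y = 0")
  case True
  obtain k :: 'n where True by simp
  have "0 \<le> c"
    using bound[of "axis k 1"] by (simp add: inner_axis_axis) 
  then show ?thesis using True by simp
next
  case False
  then have y: "norm y > 0" by auto
  \<comment> \<open>Pointing x along w y makes the inner product with w y maximal; giving it the
    length of y makes the parallelogram bound sharp.\<close>
  define x where "x = (norm y / norm (w *v y)) *\<^sub>R (w *v y)"
  have nx: "norm x = norm y" using False by (simp add: x_def)
  have yx: "y \<bullet> (w *v x) = x \<bullet> (w *v y)"
    by (metis inner_commute inner_matrix_vector_symmetric sym)
  have "4 * (x \<bullet> (w *v y)) = (x + y) \<bullet> (w *v (x + y)) - (x - y) \<bullet> (w *v (x - y))"
    using yx by (simp add: algebra_simps inner_add_left inner_add_right inner_diff_left inner_diff_right)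
  also have "\<dots> \<le> c * ((x + y) \<bullet> (x + y)) + c * ((x - y) \<bullet> (x - y))"
    using bound[of "x + y"] bound[of "x - y"] by linarith
  also have "\<dots> = 2 * c * ((norm x)\<^sup>2 + (norm y)\<^sup>2)"
    by (simp add: power2_norm_eq_inner inner_add_left inner_add_right inner_diff_left inner_diff_right algebra_simps)
  also have "\<dots> = 4 * (c * norm y * norm y)" by (simp add: nx power2_eq_square)
  finally have "x \<bullet> (w *v y) \<le> c * norm y * norm y" by simp
  moreover have "x \<bullet> (w *v y) = norm y * norm (w *v y)"
    using False by (simp add: x_def power2_norm_eq_inner[symmetric] power2_eq_square)
  ultimately have "norm y * norm (w *v y) \<le> norm y * (c * norm y)" by (simp add: mult_ac)
  then show ?thesis using y by simp
qed

text \<open>The square root is Hoelder continuous with exponent 1/2 in operator norm, by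
  \<open>psd_sqrt_distance\<close>; limits are then taken entrywise.\<close>

lemma continuous_on_msqrt: "continuous_on psd (msqrt :: real^'n^'n \<Rightarrow> _)"
proof -
  have "((msqrt :: real^'n^'n \<Rightarrow> _) \<longlongrightarrow> msqrt A) (at A within psd)" if A: "A \<in> psd" for A
  proof -
    have le: "norm ((msqrt B - msqrt A) *v x) \<le> sqrt (norm (B - A)) * norm x" if "B \<in> psd" for B x
      using psd_sqrt_distance[OF msqrt_psd[OF that] msqrt_psd[OF A]] that A
      by (intro symmetric_norm_bound) (simp_all add: transpose_diff psd_symmetric msqrt_psd msqrt_square)
    have lim: "((\<lambda>B. sqrt (norm (B - A))) \<longlongrightarrow> sqrt (norm (A - A))) (at A within psd)"
      by (intro tendsto_intros)
    have "((\<lambda>B. msqrt B $ i $ j) \<longlongrightarrow> msqrt A $ i $ j) (at A within psd)" for i j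
    proof (rule Lim_null_comparison[THEN LIM_zero_cancel])
      show "((\<lambda>B. sqrt (norm (B - A))) \<longlongrightarrow> 0) (at A within psd)" using lim by simp
      have "norm (msqrt B $ i $ j - msqrt A $ i $ j) \<le> sqrt (norm (B - A))" if "B \<in> psd" for B
      proof -
        have "norm (msqrt B $ i $ j - msqrt A $ i $ j) = norm (((msqrt B - msqrt A) *v axis j 1) $ i)"
          by (simp add: matrix_vector_mul_component inner_axis)
        also have "\<dots> \<le> norm ((msqrt B - msqrt A) *v axis j 1)" by (rule Finite_Cartesian_Product.norm_nth_le)
        also have "\<dots> \<le> sqrt (norm (B - A))" using le[OF that, of "axis j 1"] by simp
        finally show ?thesis .
      qed
      then show "\<forall>\<^sub>F B in at A within psd. norm (msqrt B $ i $ j - msqrt A $ i $ j) \<le> sqrt (norm (B - A))"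
        by (simp add: eventually_at_filter)
    qed
    then show ?thesis by (intro vec_tendstoI)
  qed
  then show ?thesis by (simp add: continuous_on_def)
qed

section \<open>Supports in squared coordinates\<close>

text \<open>The closure of \<open>ballD\<close>. Supports are closed, so the boundary of the matrix
  ball has to be included.\<close>

definition contractions :: "(real^'n^'n) set" where
  "contractions = {v. \<forall>x. norm (v *v x) \<le> norm x}"

lemma contractionsD: "v \<in> contractions \<Longrightarrow> norm (v *v x) \<le> norm x"
  by (simp add: contractions_def)

lemma contractions_transpose:
  assumes "v \<in> contractions" shows "transpose v \<in> contractions"
  unfolding contractions_def
proof clarify
  fix x
  let ?y = "transpose v *v x"
  have "norm ?y * norm ?y = x \<bullet> (v *v ?y)"
    by (metis inner_matrix_vector_left inner_commute power2_eq_square power2_norm_eq_inner)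
  also have "\<dots> \<le> norm x * norm ?y"
    using contractionsD[OF assms, of ?y] by (meson mult_left_mono norm_cauchy_schwarz norm_ge_zero order_trans)
  finally show "norm ?y \<le> norm x"
    by (metis mult_right_le_imp_le norm_ge_zero order_le_less)
qed

lemma compact_contractions: "compact (contractions :: (real^'n^'n) set)"
proof -
  have "closed (contractions :: (real^'n^'n) set)"
    unfolding contractions_def
    by (intro closed_Collect_all closed_Collect_le continuous_intros)
  moreover have "norm v \<le> (\<Sum>i\<in>(UNIV::'n set). \<Sum>j\<in>(UNIV::'n set). 1)"
    if v: "v \<in> contractions" for v :: "real^'n^'n"
  proof -
    have entry: "\<bar>v $ i $ j\<bar> \<le> 1" for i j
    proof -
      have "\<bar>v $ i $ j\<bar> = norm ((v *v axis j 1) $ i)"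
        by (simp add: matrix_vector_mul_component inner_axis)
      also have "\<dots> \<le> norm (v *v axis j 1)" by (rule Finite_Cartesian_Product.norm_nth_le)
      also have "\<dots> \<le> 1" using contractionsD[OF v, of "axis j 1"] by simp
      finally show ?thesis .
    qed
    have "norm v \<le> (\<Sum>i\<in>UNIV. norm (v $ i))"
      unfolding norm_vec_def by (rule L2_set_le_sum) simp
    also have "\<dots> \<le> (\<Sum>i\<in>UNIV. \<Sum>j\<in>UNIV. \<bar>v $ i $ j\<bar>)"
      by (rule sum_mono) (rule norm_le_l1_cart)
    also have "\<dots> \<le> (\<Sum>i\<in>(UNIV::'n set). \<Sum>j\<in>(UNIV::'n set). 1)"
      by (intro sum_mono entry)
    finally show ?thesis .
  qed
  then have "bounded (contractions :: (real^'n^'n) set)" by (rule boundedI)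
  ultimately show ?thesis by (simp add: compact_eq_bounded_closed)
qed

text \<open>The radicand in the definition of the convolution.\<close>

definition mixture :: "real^'n^'n \<Rightarrow> real^'n^'n \<Rightarrow> real^'n^'n \<Rightarrow> real^'n^'n" where
  "mixture r s v = r ** r + s ** s + s ** v ** r + r ** transpose v ** s"

text \<open>As v does not increase norms, the form at x is at least the square of the difference of
  the norms of r x and s x.\<close>

lemma mixture_psd:
  assumes "transpose r = r" "transpose s = s" "v \<in> contractions"
  shows "mixture r s v \<in> psd"
proof (rule psdI)
  show "transpose (mixture r s v) = mixture r s v"
    using assms by (simp add: mixture_def transpose_add matrix_transpose_mul matrix_mul_assoc)
  fix x
  have "(s *v x) \<bullet> (v *v (r *v x)) \<ge> - (norm (s *v x) * norm (r *v x))"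
  proof -
    have "\<bar>(s *v x) \<bullet> (v *v (r *v x))\<bar> \<le> norm (s *v x) * norm (v *v (r *v x))"
      by (rule Cauchy_Schwarz_ineq2)
    also have "\<dots> \<le> norm (s *v x) * norm (r *v x)"
      by (intro mult_left_mono contractionsD assms norm_ge_zero)
    finally show ?thesis by linarith
  qed
  moreover have "x \<bullet> (mixture r s v *v x) = (norm (r *v x))\<^sup>2 + (norm (s *v x))\<^sup>2 + 2 * ((s *v x) \<bullet> (v *v (r *v x)))"
  proof -
    have "x \<bullet> (s *v (v *v (r *v x))) = (s *v x) \<bullet> (v *v (r *v x))"
      using assms by (simp add: inner_matrix_vector_symmetric)
    moreover have "x \<bullet> (r *v (transpose v *v (s *v x))) = (s *v x) \<bullet> (v *v (r *v x))"
      using assms by (metis inner_commute inner_matrix_vector_left transpose_transpose)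
    ultimately show ?thesis
      using assms by (simp add: mixture_def matrix_vector_mult_add_rdistrib inner_add_right
          matrix_vector_mul_assoc[symmetric] power2_norm_eq_inner inner_matrix_vector_symmetric)
  qed
  moreover have "2 * (norm (s *v x) * norm (r *v x)) \<le> (norm (r *v x))\<^sup>2 + (norm (s *v x))\<^sup>2"
    using sum_squares_bound[of "norm (s *v x)" "norm (r *v x)"] by simp
  ultimately show "0 \<le> x \<bullet> (mixture r s v *v x)" by linarith
qed

definition mixtures :: "real^'n^'n \<Rightarrow> real^'n^'n \<Rightarrow> (real^'n^'n) set" where
  "mixtures R S = mixture (msqrt R) (msqrt S) ` contractions"

lemma mixtures_psd: "R \<in> psd \<Longrightarrow> S \<in> psd \<Longrightarrow> mixtures R S \<subseteq> psd"
  unfolding mixtures_def by (auto intro!: mixture_psd simp: psd_symmetric msqrt_psd)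

lemma invertible_matrix_inv:
  assumes "invertible (A :: real^'n^'n)"
  shows "A ** matrix_inv A = mat 1" "matrix_inv A ** A = mat 1"
  using assms unfolding invertible_def matrix_inv_def by (metis (mono_tags, lifting) someI_ex)+

lemma invertible_if_kernel_trivial:
  "(\<And>x. A *v x = 0 \<Longrightarrow> x = 0) \<Longrightarrow> invertible (A :: real^'n^'n)"
  unfolding invertible_left_inverse matrix_left_invertible_ker by blast

text \<open>Approximation of R by matrices whose roots are invertible, for transferring
  factorisations to singular matrices.\<close>

lemma msqrt_regularized:
  fixes R :: "real^'n^'n"
  assumes "R \<in> psd"
  defines "R' \<equiv> \<lambda>k. R + inverse (real (Suc k)) *\<^sub>R mat 1"
  shows "R' k \<in> psd" "invertible (msqrt (R' k))" "(\<lambda>k. msqrt (R' k)) \<longlonglongrightarrow> msqrt R"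
    "R' \<longlonglongrightarrow> R"
proof -
  show R': "R' k \<in> psd" for k
    unfolding R'_def by (intro psd_add psd_scaleR assms) auto
  show "invertible (msqrt (R' k))"
  proof (rule invertible_if_kernel_trivial)
    fix x assume "msqrt (R' k) *v x = 0"
    then have "R' k *v x = 0"
      by (metis R' matrix_vector_mul_assoc matrix_vector_mult_0_right msqrt_square)
    then have "x \<bullet> (R *v x) + inverse (real (Suc k)) * (x \<bullet> x) = 0"
      by (metis R'_def inner_add_right inner_scaleR_right inner_zero_right matrix_vector_mul_lid
          matrix_vector_mult_add_rdistrib scaleR_matrix_vector)
    moreover have "x \<bullet> (R *v x) \<ge> 0" by (rule psd_nonneg[OF assms(1)])
    ultimately have "inverse (real (Suc k)) * (x \<bullet> x) \<le> 0" by linarith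
    then have "x \<bullet> x \<le> 0" by (simp add: mult_le_0_iff)
    then show "x = 0" by (metis inner_eq_zero_iff inner_ge_zero order_antisym)
  qed
  have "R' \<longlonglongrightarrow> R + 0 *\<^sub>R mat 1"
    unfolding R'_def by (intro tendsto_intros LIMSEQ_inverse_real_of_nat)
  then show lim: "R' \<longlonglongrightarrow> R" by simp
  show "(\<lambda>k. msqrt (R' k)) \<longlonglongrightarrow> msqrt R"
    using continuous_on_tendsto_compose[OF continuous_on_msqrt lim assms(1)] R' by simp
qed

text \<open>If r = \<open>msqrt R\<close> is invertible, then w = r^-1 Y r^-1 lies between -I and I
  and is therefore a contraction. In general the same is done for R + I/(k+1), which dominates R,
  and a subsequence of the resulting contractions converges by compactness.\<close>

lemma order_interval_factor:
  fixes R Y :: "real^'n^'n"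
  assumes R: "R \<in> psd" and Y: "R - Y \<in> psd" "R + Y \<in> psd"
  shows "\<exists>w\<in>contractions. transpose w = w \<and> Y = msqrt R ** w ** msqrt R"
proof -
  define R' where "R' k = R + inverse (real (Suc k)) *\<^sub>R mat 1" for k
  define r where "r k = msqrt (R' k)" for k
  note reg = msqrt_regularized[OF R, folded R'_def r_def]
  have rsym: "transpose (r k) = r k" for k
    unfolding r_def by (intro psd_symmetric msqrt_psd reg)
  \<comment> \<open>Symmetry of Y comes from 2 Y = (R + Y) - (R - Y).\<close>
  have "transpose (R + Y - (R - Y)) = R + Y - (R - Y)"
    using psd_symmetric[OF Y(1)] psd_symmetric[OF Y(2)] by (simp only: transpose_diff)
  then have "transpose (2 *\<^sub>R Y) = 2 *\<^sub>R Y" by (simp add: scaleR_2)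
  then have Ysym: "transpose Y = Y" by (simp add: transpose_scalar)
  let ?W = "contractions \<inter> {w. transpose w = w}"
  have "\<exists>w\<in>?W. Y = r k ** w ** r k" for k
  proof -
    define i where "i = matrix_inv (r k)"
    have i: "r k ** i = mat 1" "i ** r k = mat 1"
      unfolding i_def using invertible_matrix_inv[OF reg(2)] by auto
    have isym: "transpose i = i"
    proof -
      have "transpose i ** r k = mat 1" using arg_cong[OF i(1), of transpose] rsym
        by (simp add: matrix_transpose_mul)
      then have "transpose i ** (r k ** i) = i" by (metis matrix_mul_assoc matrix_mul_lid)
      then show ?thesis using i by simp
    qed
    define w where "w = i ** Y ** i"
    have wsym: "transpose w = w"
      by (simp add: w_def matrix_transpose_mul isym Ysym matrix_mul_assoc)
    have "\<bar>x \<bullet> (w *v x)\<bar> \<le> 1 * (x \<bullet> x)" for x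
    proof -
      let ?y = "i *v x"
      have xw: "x \<bullet> (w *v x) = ?y \<bullet> (Y *v ?y)"
        by (simp add: w_def matrix_vector_mul_assoc[symmetric] inner_matrix_vector_symmetric[OF isym])
      have "x = r k *v ?y" using i by (simp add: matrix_vector_mul_assoc)
      then have "x \<bullet> x = ?y \<bullet> (R' k *v ?y)"
        by (metis inner_matrix_vector_symmetric matrix_vector_mul_assoc msqrt_square r_def reg(1) rsym)
      also have "\<dots> = ?y \<bullet> (R *v ?y) + inverse (real (Suc k)) * (?y \<bullet> ?y)"
        unfolding R'_def
        by (simp only: matrix_vector_mult_add_rdistrib scaleR_matrix_vector matrix_vector_mul_lid
            inner_add_right inner_scaleR_right)
      finally have "?y \<bullet> (R *v ?y) \<le> x \<bullet> x" by simp
      then show ?thesis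
        using psd_nonneg[OF Y(1), of ?y] psd_nonneg[OF Y(2), of ?y] unfolding xw
        by (simp add: matrix_vector_mult_add_rdistrib matrix_vector_mult_diff_rdistrib
            inner_add_right inner_diff_right abs_le_iff)
    qed
    then have "w \<in> contractions"
      using symmetric_norm_bound[OF wsym, of 1] by (simp add: contractions_def)
    moreover have "r k ** w ** r k = (r k ** i) ** Y ** (i ** r k)"
      by (simp only: w_def matrix_mul_assoc)
    ultimately show ?thesis using wsym i by auto
  qed
  then have "\<forall>k. \<exists>w. w \<in> ?W \<and> Y = r k ** w ** r k" by blast
  from choice[OF this] obtain w where w: "\<And>k. w k \<in> ?W" "\<And>k. Y = r k ** w k ** r k" by blast
  have "compact ?W"
    by (intro compact_Int_closed compact_contractions closed_Collect_eq continuous_intros)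
  then obtain l g where l: "l \<in> ?W" and g: "strict_mono g" "(w \<circ> g) \<longlonglongrightarrow> l"
    using w(1) unfolding compact_def by blast
  have "(\<lambda>k. r (g k) ** (w \<circ> g) k ** r (g k)) \<longlonglongrightarrow> msqrt R ** l ** msqrt R"
    using LIMSEQ_subseq_LIMSEQ[OF reg(3) g(1)] g(2)
    by (intro tendsto_intros) (simp_all add: o_def)
  then have "(\<lambda>k. Y) \<longlonglongrightarrow> msqrt R ** l ** msqrt R" using w(2) by simp
  then have "Y = msqrt R ** l ** msqrt R" by (simp add: LIMSEQ_const_iff)
  then show ?thesis using l by blast
qed

section \<open>The Loewner order and the two special supports\<close>

definition loewner_le :: "real^'n^'n \<Rightarrow> real^'n^'n \<Rightarrow> bool" (infix \<open>\<preceq>\<close> 50) where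
  "A \<preceq> B \<longleftrightarrow> B - A \<in> psd"

lemma loewner_leD: "A \<preceq> B \<Longrightarrow> x \<bullet> (A *v x) \<le> x \<bullet> (B *v x)"
  using psd_nonneg[of "B - A" x]
  by (simp add: loewner_le_def matrix_vector_mult_diff_rdistrib inner_diff_right)

lemma loewner_leI:
  "transpose A = A \<Longrightarrow> transpose B = B \<Longrightarrow> (\<And>x. x \<bullet> (A *v x) \<le> x \<bullet> (B *v x)) \<Longrightarrow> A \<preceq> B"
  unfolding loewner_le_def
  by (rule psdI) (simp_all add: transpose_diff matrix_vector_mult_diff_rdistrib inner_diff_right)

lemma loewner_le_refl [simp]: "A \<preceq> A"
  by (simp add: loewner_le_def)

lemma loewner_le_trans: "A \<preceq> B \<Longrightarrow> B \<preceq> C \<Longrightarrow> A \<preceq> C"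
  unfolding loewner_le_def using psd_add[of "B - A" "C - B"] by simp

lemma loewner_le_scaleR_iff: "0 < c \<Longrightarrow> c *\<^sub>R A \<preceq> c *\<^sub>R B \<longleftrightarrow> A \<preceq> B"
  unfolding loewner_le_def scaleR_diff_right[symmetric]
  using psd_scaleR[of "B - A" c] psd_scaleR[of "c *\<^sub>R (B - A)" "inverse c"] by auto

text \<open>With r = s the mixture is X = 2 R + r (v + v^T) r. Replacing v by -v turns X into 4 R -
  X, which is again positive semidefinite; conversely X/2 - R lies between -R and R and factors
  through r with a symmetric contraction.\<close>

lemma mixtures_self:
  fixes R :: "real^'n^'n"
  assumes R: "R \<in> psd"
  shows "mixtures R R = {X \<in> psd. X \<preceq> 4 *\<^sub>R R}"
proof (intro equalityI subsetI)
  let ?r = "msqrt R"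
  have rsym: "transpose ?r = ?r" by (intro psd_symmetric msqrt_psd R)
  {
    fix X assume "X \<in> mixtures R R"
    then obtain v where v: "v \<in> contractions" and X: "X = mixture ?r ?r v"
      unfolding mixtures_def by blast
    have "(0 - v) *v x = - (v *v x)" for x by (simp only: matrix_vector_mult_diff_rdistrib) simp
    then have "0 - v \<in> contractions"
      using v unfolding contractions_def by (simp only: mem_Collect_eq norm_minus_cancel) simp
    then have "mixture ?r ?r (0 - v) \<in> psd" by (intro mixture_psd rsym)
    moreover have "mixture ?r ?r (0 - v) = 4 *\<^sub>R R - X"
    proof -
      have four: "4 *\<^sub>R R = R + R + R + R" by (simp add: vec_eq_iff)
      show ?thesis
        unfolding X mixture_def transpose_diff matrix_sub_ldistrib matrix_sub_rdistrib msqrt_square[OF R] four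
        by simp
    qed
    ultimately show "X \<in> {X \<in> psd. X \<preceq> 4 *\<^sub>R R}"
      using mixtures_psd[OF R R] \<open>X \<in> mixtures R R\<close> by (auto simp: loewner_le_def)
  }
  fix X assume "X \<in> {X \<in> psd. X \<preceq> 4 *\<^sub>R R}"
  then have X: "X \<in> psd" "4 *\<^sub>R R - X \<in> psd" by (auto simp: loewner_le_def)
  have "\<exists>w\<in>contractions. transpose w = w \<and> (1/2) *\<^sub>R X - R = ?r ** w ** ?r"
  proof (rule order_interval_factor[OF R])
    have "R - ((1/2) *\<^sub>R X - R) = (1/2) *\<^sub>R (4 *\<^sub>R R - X)"
      by (simp add: vec_eq_iff)
    then show "R - ((1/2) *\<^sub>R X - R) \<in> psd" using psd_scaleR[OF X(2), of "1/2"] by simp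
    show "R + ((1/2) *\<^sub>R X - R) \<in> psd" using psd_scaleR[OF X(1), of "1/2"] by simp
  qed
  then obtain w where w: "w \<in> contractions" "transpose w = w" "(1/2) *\<^sub>R X - R = ?r ** w ** ?r" by blast
  have "X = 2 *\<^sub>R (R + ((1/2) *\<^sub>R X - R))" by simp
  then have "X = mixture ?r ?r w"
    unfolding w(3) mixture_def w(2) msqrt_square[OF R] by (simp add: scaleR_2)
  then show "X \<in> mixtures R R" using w(1) unfolding mixtures_def by blast
qed

text \<open>The factor corrects (x x^T)^2 = |x|^2 x x^T; the convention \<open>inverse 0 = 0\<close>
  makes the formula valid at x = 0.\<close>

lemma msqrt_outer: "msqrt (outer x x) = inverse (norm x) *\<^sub>R outer x x"
proof (rule msqrt_eqI)
  show "inverse (norm x) *\<^sub>R outer x x \<in> psd" by (intro psd_scaleR psd_outer) simp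
  show "inverse (norm x) *\<^sub>R outer x x ** inverse (norm x) *\<^sub>R outer x x = outer x x"
    by (cases "x = 0")
      (simp_all add: scaleR_matrix_mult_left scaleR_matrix_mult_right matrix_mult_outer outer_vector_mult
        outer_scaleR_left scaleR_matrix_vector power2_norm_eq_inner[symmetric] power2_eq_square field_simps)
qed

text \<open>The two roots have rank one, so v enters only through the scalar y . v x divided by the
  norms of x and y. It ranges over all of [-1, 1] for nonzero x and y, and the mixture is affine in
  it.\<close>

lemma mixtures_outer:
  fixes x y :: "real^'n"
  shows "mixtures (outer x x) (outer y y) =
    closed_segment (outer (x - y) (x - y)) (outer (x + y) (x + y))"
proof -
  define P where "P c = outer x x + outer y y + c *\<^sub>R (outer x y + outer y x)" for c
  let ?n = "inverse (norm x) * inverse (norm y)"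
  have mix: "mixture (msqrt (outer x x)) (msqrt (outer y y)) v = P (?n * (y \<bullet> (v *v x)))" for v
  proof -
    have 1: "msqrt (outer y y) ** v ** msqrt (outer x x) = (?n * (y \<bullet> (v *v x))) *\<^sub>R outer y x"
      by (simp add: msqrt_outer scaleR_matrix_mult_left scaleR_matrix_mult_right matrix_mult_outer
          outer_matrix_mult outer_vector_mult outer_scaleR_left scaleR_matrix_vector
          inner_matrix_vector_left mult_ac)
    have "msqrt (outer x x) ** transpose v ** msqrt (outer y y)
        = transpose (msqrt (outer y y) ** v ** msqrt (outer x x))"
      by (simp add: matrix_transpose_mul psd_symmetric msqrt_psd psd_outer matrix_mul_assoc)
    then have 2: "msqrt (outer x x) ** transpose v ** msqrt (outer y y) = (?n * (y \<bullet> (v *v x))) *\<^sub>R outer x y"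
      by (simp add: 1 transpose_scalar transpose_outer)
    show ?thesis
      unfolding mixture_def 1 2 P_def by (simp add: msqrt_square psd_outer scaleR_add_right)
  qed
  have "mixtures (outer x x) (outer y y) = P ` {-1..1}"
  proof (intro equalityI subsetI)
    fix X assume "X \<in> mixtures (outer x x) (outer y y)"
    then obtain v where v: "v \<in> contractions" and X: "X = P (?n * (y \<bullet> (v *v x)))"
      unfolding mixtures_def mix by blast
    have "\<bar>y \<bullet> (v *v x)\<bar> \<le> norm y * norm x"
      using Cauchy_Schwarz_ineq2[of y "v *v x"] contractionsD[OF v, of x]
      by (meson mult_left_mono norm_ge_zero order_trans)
    then have "\<bar>?n * (y \<bullet> (v *v x))\<bar> \<le> ?n * (norm y * norm x)"
      unfolding abs_mult by (simp add: mult_left_mono)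
    also have "\<dots> \<le> 1" by (cases "x = 0 \<or> y = 0") (auto simp: field_simps)
    finally show "X \<in> P ` {-1..1}" unfolding X by (auto simp: abs_le_iff)
  next
    fix X assume "X \<in> P ` {-1..1}"
    then obtain c where c: "\<bar>c\<bar> \<le> 1" and X: "X = P c" by (auto simp: abs_le_iff)
    \<comment> \<open>The rank-one contraction that sends x/|x| to c y/|y|.\<close>
    define v where "v = (c * ?n) *\<^sub>R outer y x"
    have "v \<in> contractions"
      unfolding contractions_def
    proof clarify
      fix z
      have "norm (v *v z) = \<bar>c\<bar> * (inverse (norm x) * \<bar>x \<bullet> z\<bar>) * (inverse (norm y) * norm y)"
        by (simp add: v_def scaleR_matrix_vector outer_vector_mult abs_mult mult_ac)
      also have "\<dots> \<le> 1 * norm z * 1"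
      proof (intro mult_mono)
        show "inverse (norm x) * \<bar>x \<bullet> z\<bar> \<le> norm z"
          using Cauchy_Schwarz_ineq2[of x z] by (cases "x = 0") (simp_all add: field_simps)
        show "inverse (norm y) * norm y \<le> 1" by (cases "y = 0") auto
      qed (use c in auto)
      finally show "norm (v *v z) \<le> norm z" by simp
    qed
    moreover have "P (?n * (y \<bullet> (v *v x))) = P c"
    proof (cases "x = 0 \<or> y = 0")
      case True
      then show ?thesis by (auto simp: P_def)
    next
      case False
      have "y \<bullet> (v *v x) = c * ?n * ((norm x)\<^sup>2 * (norm y)\<^sup>2)"
        by (simp add: v_def scaleR_matrix_vector outer_vector_mult power2_norm_eq_inner)
      then have "?n * (y \<bullet> (v *v x)) = c"
        using False by (simp add: field_simps power2_eq_square)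
      then show ?thesis by simp
    qed
    ultimately show "X \<in> mixtures (outer x x) (outer y y)"
      unfolding mixtures_def mix X by force
  qed
  also have "\<dots> = closed_segment (P (-1)) (P 1)"
  proof -
    have "closed_segment (P (-1)) (P 1) = (\<lambda>u. P (2 * u - 1)) ` {0..1}"
      unfolding closed_segment_image_interval
      by (rule image_cong) (simp_all add: P_def vec_eq_iff algebra_simps)
    also have "\<dots> = P ` ((\<lambda>u. 2 * u - 1) ` {0..1})" by (simp add: image_image)
    also have "(\<lambda>u::real. 2 * u - 1) ` {0..1} = {-1..1}"
      using image_affinity_atLeastAtMost_diff[of 2 1 0 1] by simp
    finally show ?thesis by simp
  qed
  also have "P (-1) = outer (x - y) (x - y)"
    by (simp add: P_def outer_diff_left outer_diff_right)
  also have "P 1 = outer (x + y) (x + y)"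
    by (simp add: P_def outer_add_left outer_add_right)
  finally show ?thesis .
qed

section \<open>Order automorphisms\<close>

text \<open>Endpoints are recognised topologically: every other point of a segment is a cut
  point.\<close>

lemma connected_segment_minus_point:
  fixes c d p :: "'a::euclidean_space"
  assumes "p \<in> closed_segment c d" "connected (closed_segment c d - {p})"
  shows "p = c \<or> p = d"
proof (rule ccontr)
  assume p: "\<not> (p = c \<or> p = d)"
  obtain u where u: "0 \<le> u" "u \<le> 1" "p = (1 - u) *\<^sub>R c + u *\<^sub>R d"
    using assms(1) by (auto simp: closed_segment_def)
  have cd: "c \<noteq> d" using p u by (auto simp: algebra_simps)
  have "u \<noteq> 0" "u \<noteq> 1" using p u by auto
  then have u': "0 < u" "u < 1" using u by auto
  \<comment> \<open>On the segment this functional vanishes only at p and has opposite signs at the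
    two ends.\<close>
  let ?g = "\<lambda>z. (z - p) \<bullet> (d - c)"
  have conn: "connected (?g ` (closed_segment c d - {p}))"
    by (intro connected_continuous_image assms continuous_intros)
  have "c - p = (- u) *\<^sub>R (d - c)" "d - p = (1 - u) *\<^sub>R (d - c)"
    by (simp_all add: u(3) algebra_simps)
  then have g: "?g c = - u * ((d - c) \<bullet> (d - c))" "?g d = (1 - u) * ((d - c) \<bullet> (d - c))"
    by (simp_all only: inner_scaleR_left)
  moreover have "(d - c) \<bullet> (d - c) > 0" using cd by simp
  ultimately have "?g c < 0" "?g d > 0" using u' by simp_all
  moreover have "?g c \<in> ?g ` (closed_segment c d - {p})" "?g d \<in> ?g ` (closed_segment c d - {p})"
    using p by auto
  ultimately have "0 \<in> ?g ` (closed_segment c d - {p})"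
    using conn unfolding connected_iff_interval by (meson less_imp_le)
  then obtain z where "0 = ?g z" "z \<in> closed_segment c d - {p}" by (rule imageE)
  then have z: "z \<in> closed_segment c d" "z \<noteq> p" "?g z = 0" by simp_all
  obtain t where t: "z = (1 - t) *\<^sub>R c + t *\<^sub>R d"
    using z(1) by (auto simp: closed_segment_def)
  have "z - p = (t - u) *\<^sub>R (d - c)" by (simp add: t u(3) algebra_simps)
  then have "(t - u) * ((d - c) \<bullet> (d - c)) = 0" using z(3) by simp
  then show False using cd z(2) t u(3) by auto
qed

lemma connected_segment_minus_endpoint:
  fixes a b :: "'a::euclidean_space"
  shows "connected (closed_segment a b - {a})"
proof (cases "a = b")
  case False
  have "closed_segment a b - {a} = (\<lambda>u. (1 - u) *\<^sub>R a + u *\<^sub>R b) ` {0<..1}"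
  proof -
    have "(1 - u) *\<^sub>R a + u *\<^sub>R b = a \<longleftrightarrow> u = 0" for u
    proof -
      have "(1 - u) *\<^sub>R a + u *\<^sub>R b = a \<longleftrightarrow> u *\<^sub>R (b - a) = 0" by (simp add: algebra_simps)
      then show ?thesis using False by simp
    qed
    then show ?thesis unfolding closed_segment_image_interval by force
  qed
  then show ?thesis
    by (auto intro!: connected_continuous_image continuous_intros)
qed simp

text \<open>Being a non-cut point is a topological property, so endpoints go to endpoints. Their
  order is not controlled, hence the unordered pairs.\<close>

lemma segment_endpoints_preserved:
  fixes f :: "'a::euclidean_space \<Rightarrow> 'b::euclidean_space"
  assumes cont: "continuous_on (closed_segment a b) f" and inj: "inj_on f (closed_segment a b)"
    and img: "f ` closed_segment a b = closed_segment c d"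
  shows "{f a, f b} = {c, d}"
proof -
  have end1: "f p = c \<or> f p = d" if "p \<in> closed_segment a b" "connected (closed_segment a b - {p})" for p
  proof (rule connected_segment_minus_point)
    show "f p \<in> closed_segment c d" using that img by blast
    have "closed_segment c d - {f p} = f ` (closed_segment a b - {p})"
      using inj that(1) unfolding img[symmetric] inj_on_def by blast
    then show "connected (closed_segment c d - {f p})"
      using that(2) cont by (metis Diff_subset connected_continuous_image continuous_on_subset)
  qed
  have a: "f a = c \<or> f a = d" by (intro end1 connected_segment_minus_endpoint) simp
  have b: "f b = c \<or> f b = d"
    using connected_segment_minus_endpoint[of b a] by (intro end1) (simp_all add: closed_segment_commute)
  show ?thesis
  proof (cases "a = b")
    case True
    then have "closed_segment c d = {f a}" using img by simp
    then have "c = f a" "d = f a" by (metis ends_in_segment singletonD)+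
    then show ?thesis using True by simp
  next
    case False
    then have "f a \<noteq> f b" using inj by (meson ends_in_segment inj_onD)
    then show ?thesis using a b by auto
  qed
qed

section \<open>Rank-one matrices below a given matrix\<close>

lemma outer_form: "y \<bullet> (outer x x *v y) = (x \<bullet> y)\<^sup>2"
  by (simp add: outer_vector_mult power2_eq_square inner_commute)

text \<open>By Cauchy-Schwarz for the form of R, the projection of R along z, which is (R z)(R z)^T
  divided by z . R z, stays below R, and it agrees with R on z.\<close>

lemma rank_one_below:
  assumes "R \<in> psd" "z \<bullet> (R *v z) \<noteq> 0"
  defines "w \<equiv> inverse (sqrt (z \<bullet> (R *v z))) *\<^sub>R (R *v z)"
  shows "outer w w \<preceq> R" and "(w \<bullet> z)\<^sup>2 = z \<bullet> (R *v z)" and "outer w w *v z = R *v z"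
proof -
  define q where "q = z \<bullet> (R *v z)"
  have q: "q > 0" using psd_nonneg[OF assms(1), of z] assms(2) by (simp add: q_def)
  have w: "w = inverse (sqrt q) *\<^sub>R (R *v z)" by (simp add: w_def q_def)
  have wz: "w \<bullet> z = sqrt q" using q by (simp add: w q_def[symmetric] inner_commute field_simps)
  then show "(w \<bullet> z)\<^sup>2 = z \<bullet> (R *v z)" using q by (simp add: q_def)
  show "outer w w *v z = R *v z" using q wz by (simp add: outer_vector_mult w)
  show "outer w w \<preceq> R"
  proof (rule loewner_leI)
    fix x
    have "(x \<bullet> (R *v z))\<^sup>2 \<le> (x \<bullet> (R *v x)) * q"
      unfolding q_def by (rule psd_Cauchy_Schwarz[OF assms(1)])
    then show "x \<bullet> (outer w w *v x) \<le> x \<bullet> (R *v x)"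
      using q by (simp add: outer_form w power_mult_distrib inner_commute power_inverse field_simps)
  qed (use assms in \<open>simp_all add: transpose_outer psd_symmetric\<close>)
qed

text \<open>For each z with z . R z nonzero, the matrix of \<open>rank_one_below\<close> lies below
  R and has the same value at z, so comparing rank-one matrices is enough.\<close>

lemma psd_le_by_rank_one:
  assumes "R \<in> psd" "R' \<in> psd" "\<And>x. outer x x \<preceq> R \<Longrightarrow> outer x x \<preceq> R'"
  shows "R \<preceq> R'"
proof (rule loewner_leI)
  fix z
  show "z \<bullet> (R *v z) \<le> z \<bullet> (R' *v z)"
  proof (cases "z \<bullet> (R *v z) = 0")
    case True
    then show ?thesis using psd_nonneg[OF assms(2)] by simp
  next
    case False
    note w = rank_one_below[OF assms(1) False]
    show ?thesis using loewner_leD[OF assms(3)[OF w(1)], of z] by (simp only: outer_form w(2))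
  qed
qed (use assms psd_symmetric in auto)

lemma loewner_le_antisym:
  assumes "A \<preceq> B" "B \<preceq> A" shows "A = B"
proof -
  have "B - A = 0"
  proof (rule symmetric_form_zero)
    show "transpose (B - A) = B - A" using assms by (simp add: loewner_le_def psd_symmetric)
    show "x \<bullet> ((B - A) *v x) = 0" for x
      using loewner_leD[OF assms(1), of x] loewner_leD[OF assms(2), of x]
      by (simp add: matrix_vector_mult_diff_rdistrib inner_diff_right)
  qed
  then show ?thesis by simp
qed

text \<open>The form of A vanishes on the orthogonal complement of x, so A kills that complement and
  is determined by A x.\<close>

lemma below_outer:
  assumes A: "A \<in> psd" "A \<preceq> outer x x"
  obtains c where "A = c *\<^sub>R outer x x"
proof (cases "x = 0")
  case True
  have "A = 0"
  proof (rule symmetric_form_zero[OF psd_symmetric[OF A(1)]])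
    show "y \<bullet> (A *v y) = 0" for y
      using loewner_leD[OF A(2), of y] psd_nonneg[OF A(1), of y] True by simp
  qed
  then show ?thesis using that[of 0] by simp
next
  case False
  have ker: "A *v y = 0" if "x \<bullet> y = 0" for y
    using loewner_leD[OF A(2), of y] psd_nonneg[OF A(1), of y] that
    by (intro psd_kernel[OF A(1)]) (simp add: outer_form)
  define c where "c = (x \<bullet> (A *v x)) / (x \<bullet> x)\<^sup>2"
  have xx: "x \<bullet> x > 0" using False by simp
  have Ay: "A *v y = ((x \<bullet> y) / (x \<bullet> x)) *\<^sub>R (A *v x)" for y
  proof -
    have "A *v (y - ((x \<bullet> y) / (x \<bullet> x)) *\<^sub>R x) = 0"
      using xx by (intro ker) (simp add: inner_diff_right)
    then show ?thesis by (simp add: matrix_vector_mult_diff_distrib matrix_vector_mult_scaleR)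
  qed
  have "A - c *\<^sub>R outer x x = 0"
  proof (rule symmetric_form_zero)
    show "transpose (A - c *\<^sub>R outer x x) = A - c *\<^sub>R outer x x"
      using A by (simp add: transpose_diff transpose_scalar transpose_outer psd_symmetric)
    fix y
    have "y \<bullet> (A *v x) = x \<bullet> (A *v y)"
      by (metis A(1) inner_commute inner_matrix_vector_symmetric psd_symmetric)
    also have "\<dots> = ((x \<bullet> y) / (x \<bullet> x)) * (x \<bullet> (A *v x))" by (subst Ay) simp
    finally have yx: "y \<bullet> (A *v x) = ((x \<bullet> y) / (x \<bullet> x)) * (x \<bullet> (A *v x))" .
    have "y \<bullet> (A *v y) = ((x \<bullet> y) / (x \<bullet> x)) * (y \<bullet> (A *v x))" by (subst Ay) simp
    then show "y \<bullet> ((A - c *\<^sub>R outer x x) *v y) = 0"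
      unfolding yx using xx
      by (simp add: matrix_vector_mult_diff_rdistrib inner_diff_right scaleR_matrix_vector outer_form c_def
          power2_eq_square)
  qed
  then show ?thesis using that[of c] by simp
qed

definition loewner_chain_below :: "real^'n^'n \<Rightarrow> bool" where
  "loewner_chain_below R \<longleftrightarrow>
    (\<forall>A\<in>psd. \<forall>B\<in>psd. A \<preceq> R \<longrightarrow> B \<preceq> R \<longrightarrow> A \<preceq> B \<or> B \<preceq> A)"

text \<open>For the converse, write R = w w^T + B with w from \<open>rank_one_below\<close>, so that
  B z = 0. Of the two comparable parts, w w^T cannot be the smaller because its form at z is
  positive; so B is a multiple of w w^T, and B z = 0 makes the multiple zero. The zero matrix is
  covered by x = 0.\<close>

lemma rank_one_iff_chain_below:
  assumes R: "R \<in> psd"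
  shows "(\<exists>x. R = outer x x) \<longleftrightarrow> loewner_chain_below R"
proof
  assume "\<exists>x. R = outer x x"
  then obtain x where x: "R = outer x x" ..
  have le: "c *\<^sub>R outer x x \<preceq> d *\<^sub>R outer x x" if "c \<le> d" for c d :: real
    unfolding loewner_le_def scaleR_diff_left[symmetric]
    by (intro psd_scaleR psd_outer) (use that in simp)
  show "loewner_chain_below R"
    unfolding loewner_chain_below_def x by (metis below_outer le linear)
next
  assume chain: "loewner_chain_below R"
  show "\<exists>x. R = outer x x"
  proof (cases "\<forall>z. z \<bullet> (R *v z) = 0")
    case True
    then have "R = outer 0 0" using symmetric_form_zero[OF psd_symmetric[OF R]] by simp
    then show ?thesis ..
  next
    case False
    then obtain z where z: "z \<bullet> (R *v z) \<noteq> 0" by blast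
    obtain w where w: "outer w w \<preceq> R" "(w \<bullet> z)\<^sup>2 = z \<bullet> (R *v z)" "outer w w *v z = R *v z"
      using rank_one_below[OF R z] by blast
    define B where "B = R - outer w w"
    have B: "B \<in> psd" "B \<preceq> R"
      using w(1) by (auto simp: B_def loewner_le_def psd_outer)
    have Bz: "B *v z = 0" using w(3) by (simp add: B_def matrix_vector_mult_diff_rdistrib)
    have "\<not> outer w w \<preceq> B"
    proof
      assume "outer w w \<preceq> B"
      from loewner_leD[OF this, of z] have "(w \<bullet> z)\<^sup>2 \<le> 0" by (simp add: outer_form Bz)
      then have "(w \<bullet> z)\<^sup>2 = 0" by (metis order_antisym zero_le_power2)
      then show False using z w(2) by simp
    qed
    then have "B \<preceq> outer w w"
      using chain B w(1) psd_outer unfolding loewner_chain_below_def by blast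
    then obtain c where c: "B = c *\<^sub>R outer w w" using below_outer[OF B(1)] by blast
    have "c * (w \<bullet> z)\<^sup>2 = z \<bullet> (B *v z)" by (simp add: c scaleR_matrix_vector outer_form)
    then have "c = 0" using Bz z w(2) by simp
    then have "R = outer w w" using c by (simp add: B_def)
    then show ?thesis ..
  qed
qed

lemma additive_continuous_imp_linear:
  fixes f :: "'a::real_normed_vector \<Rightarrow> 'b::real_normed_vector"
  assumes add: "\<And>x y. f (x + y) = f x + f y" and cont: "continuous_on UNIV f"
  shows "linear f"
proof (rule linearI)
  fix c x
  interpret additive f by standard (rule add)
  have nat: "f (real n *\<^sub>R y) = real n *\<^sub>R f y" for n y
  proof (induction n)
    case (Suc n)
    have "f (real (Suc n) *\<^sub>R y) = f (real n *\<^sub>R y + y)" by (simp add: scaleR_left_distrib add.commute)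
    also have "\<dots> = real n *\<^sub>R f y + f y" by (simp only: assms(1) Suc)
    finally show ?case by (simp add: scaleR_left_distrib add.commute)
  qed (simp add: zero)
  have int: "f (of_int n *\<^sub>R y) = of_int n *\<^sub>R f y" for n y
    by (cases n rule: int_cases2) (simp_all add: nat minus del: of_nat_Suc)
  have rat: "f (q *\<^sub>R x) = q *\<^sub>R f x" if q: "q \<in> \<rat>" for q :: real
  proof -
    obtain a b where b: "b > 0" "q = of_int a / of_int b"
      using q by (rule Rats_cases')
    have "of_int b *\<^sub>R f (q *\<^sub>R x) = f (of_int b *\<^sub>R q *\<^sub>R x)" by (rule int[symmetric])
    also have "of_int b *\<^sub>R q *\<^sub>R x = of_int a *\<^sub>R x" using b by simp
    also have "f \<dots> = of_int a *\<^sub>R f x" by (rule int)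
    also have "\<dots> = of_int b *\<^sub>R (q *\<^sub>R f x)" using b by simp
    finally show ?thesis using b(1) unfolding scaleR_cancel_left by simp
  qed
  have "closed {t::real. f (t *\<^sub>R x) = t *\<^sub>R f x}"
    by (intro closed_Collect_eq continuous_intros continuous_on_compose2[OF cont]) auto
  moreover have "\<rat> \<subseteq> {t::real. f (t *\<^sub>R x) = t *\<^sub>R f x}" using rat by blast
  ultimately have "closure \<rat> \<subseteq> {t::real. f (t *\<^sub>R x) = t *\<^sub>R f x}" by (rule closure_minimal[rotated])
  then show "f (c *\<^sub>R x) = c *\<^sub>R f x" by (auto simp: Rats_closure_real)
qed (rule add)

text \<open>Recovers the order from the relation C \<preceq> 4 A alone, the only one that supports
  provide before F is known to be homogeneous. The converse takes C = 4 A.\<close>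

lemma loewner_le_iff_below_scaled:
  assumes "A \<in> psd"
  shows "A \<preceq> B \<longleftrightarrow> (\<forall>C\<in>psd. C \<preceq> 4 *\<^sub>R A \<longrightarrow> C \<preceq> 4 *\<^sub>R B)"
proof
  assume "A \<preceq> B"
  then have "4 *\<^sub>R A \<preceq> 4 *\<^sub>R B" by (simp add: loewner_le_scaleR_iff)
  then show "\<forall>C\<in>psd. C \<preceq> 4 *\<^sub>R A \<longrightarrow> C \<preceq> 4 *\<^sub>R B" using loewner_le_trans by blast
next
  assume "\<forall>C\<in>psd. C \<preceq> 4 *\<^sub>R A \<longrightarrow> C \<preceq> 4 *\<^sub>R B"
  then have "4 *\<^sub>R A \<preceq> 4 *\<^sub>R B" using psd_scaleR[OF assms, of 4] by simp
  then show "A \<preceq> B" by (simp add: loewner_le_scaleR_iff)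
qed

lemma congruence_loewner_le:
  fixes a :: "real^'n^'n"
  assumes "A \<preceq> B" shows "a ** A ** transpose a \<preceq> a ** B ** transpose a"
proof -
  have "a ** B ** transpose a - a ** A ** transpose a = a ** (B - A) ** transpose a"
    by (simp add: matrix_sub_ldistrib matrix_sub_rdistrib)
  then show ?thesis using psd_congruence[of "B - A" a] assms by (simp add: loewner_le_def)
qed

lemma congruence_outer: "a ** outer x y ** transpose a = outer (a *v x) (a *v y)"
  by (simp add: matrix_mult_outer outer_matrix_mult)

lemma mixtures_preserving_imp_congruence:
  fixes F :: "real^'n^'n \<Rightarrow> real^'n^'n"
  assumes bij: "bij_betw F psd psd" and cont: "continuous_on psd F"
    and mix: "\<And>R S. R \<in> psd \<Longrightarrow> S \<in> psd \<Longrightarrow> F ` mixtures R S = mixtures (F R) (F S)"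
  obtains a where "invertible a" "\<And>R. R \<in> psd \<Longrightarrow> F R = a ** R ** transpose a"
proof -
  have Fpsd: "F R \<in> psd" if "R \<in> psd" for R using bij that by (auto simp: bij_betw_def)
  have Finj: "inj_on F psd" using bij by (simp add: bij_betw_def)
  have Fsurj: "\<exists>R\<in>psd. F R = X" if "X \<in> psd" for X
    using bij that unfolding bij_betw_def by (metis imageE)
  have four: "A \<preceq> 4 *\<^sub>R B \<longleftrightarrow> F A \<preceq> 4 *\<^sub>R F B" if A: "A \<in> psd" and B: "B \<in> psd" for A B
  proof -
    have "A \<preceq> 4 *\<^sub>R B \<longleftrightarrow> A \<in> mixtures B B" using A by (simp add: mixtures_self[OF B])
    also have "\<dots> \<longleftrightarrow> F A \<in> F ` mixtures B B"
      using inj_on_image_mem_iff[OF Finj A mixtures_psd[OF B B]] by simp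
    also have "\<dots> \<longleftrightarrow> F A \<in> mixtures (F B) (F B)" by (simp only: mix[OF B B])
    also have "\<dots> \<longleftrightarrow> F A \<preceq> 4 *\<^sub>R F B" using Fpsd[OF A] by (simp add: mixtures_self[OF Fpsd[OF B]])
    finally show ?thesis .
  qed
  have order: "A \<preceq> B \<longleftrightarrow> F A \<preceq> F B" if A: "A \<in> psd" and B: "B \<in> psd" for A B
  proof -
    have "A \<preceq> B \<longleftrightarrow> (\<forall>C\<in>psd. F C \<preceq> 4 *\<^sub>R F A \<longrightarrow> F C \<preceq> 4 *\<^sub>R F B)"
      unfolding loewner_le_iff_below_scaled[OF A] using four A B by blast
    also have "\<dots> \<longleftrightarrow> (\<forall>C\<in>psd. C \<preceq> 4 *\<^sub>R F A \<longrightarrow> C \<preceq> 4 *\<^sub>R F B)"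
      using Fsurj Fpsd by metis
    also have "\<dots> \<longleftrightarrow> F A \<preceq> F B" by (rule loewner_le_iff_below_scaled[OF Fpsd[OF A], symmetric])
    finally show ?thesis .
  qed
  have chain: "loewner_chain_below (F R)" if R: "R \<in> psd" and ch: "loewner_chain_below R" for R
    unfolding loewner_chain_below_def
  proof (intro ballI impI)
    fix X Y assume XY: "X \<in> psd" "Y \<in> psd" "X \<preceq> F R" "Y \<preceq> F R"
    obtain A B where "A \<in> psd" "F A = X" "B \<in> psd" "F B = Y" using Fsurj XY by metis
    then show "X \<preceq> Y \<or> Y \<preceq> X"
      using XY ch order R unfolding loewner_chain_below_def by metis
  qed
  have "\<exists>y. F (outer x x) = outer y y" for x
    using rank_one_iff_chain_below[OF psd_outer, of x] rank_one_iff_chain_below[OF Fpsd[OF psd_outer], of x]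
      chain[OF psd_outer, of x] by blast
  then obtain t where t: "\<And>x. F (outer x x) = outer (t x) (t x)" by metis
  define Q where "Q x = F (outer x x)" for x
  have ends: "{Q (x - y), Q (x + y)} = {outer (t x - t y) (t x - t y), outer (t x + t y) (t x + t y)}" for x y
    unfolding Q_def
  proof (rule segment_endpoints_preserved[where f = F])
    let ?S = "closed_segment (outer (x - y) (x - y)) (outer (x + y) (x + y))"
    have "?S \<subseteq> psd" using mixtures_psd[OF psd_outer psd_outer, of x y] by (simp add: mixtures_outer)
    then show "continuous_on ?S F" "inj_on F ?S"
      using cont Finj by (auto intro: continuous_on_subset inj_on_subset)
    show "F ` ?S = closed_segment (outer (t x - t y) (t x - t y)) (outer (t x + t y) (t x + t y))"
      using mix[OF psd_outer psd_outer, of x y] unfolding t mixtures_outer .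
  qed
  have Qt: "Q x = outer (t x) (t x)" for x by (simp add: Q_def t)
  \<comment> \<open>A sum over the two endpoints is indifferent to which endpoint went
    where.\<close>
  have par: "Q (x + y) + Q (x - y) = 2 *\<^sub>R Q x + 2 *\<^sub>R Q y" for x y
  proof -
    have "Q (x + y) + Q (x - y) = outer (t x + t y) (t x + t y) + outer (t x - t y) (t x - t y)"
      using ends[of x y] by (auto simp: doubleton_eq_iff)
    also have "\<dots> = 2 *\<^sub>R Q x + 2 *\<^sub>R Q y"
      by (simp add: Qt outer_add_left outer_add_right outer_diff_left outer_diff_right scaleR_2)
    finally show ?thesis .
  qed
  \<comment> \<open>The Jordan-von Neumann argument: the parallelogram law makes Q quadratic.
    Combine the first instance minus the second plus the third, and remove \<open>Q (y - z)\<close>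
    by the fourth.\<close>
  have JvN: "Q (x + y + z) = Q (x + y) + Q (x + z) + Q (y + z) - Q x - Q y - Q z" for x y z
  proof -
    have "Q (x + y + z) + Q (x + y - z) = 2 *\<^sub>R Q (x + y) + 2 *\<^sub>R Q z" by (rule par)
    moreover have "Q (x + y - z) + Q (x - y + z) = 2 *\<^sub>R Q x + 2 *\<^sub>R Q (y - z)"
      using par[of x "y - z"] by (simp add: algebra_simps)
    moreover have "Q (x + y + z) + Q (x - y + z) = 2 *\<^sub>R Q (x + z) + 2 *\<^sub>R Q y"
      using par[of "x + z" y] by (simp add: algebra_simps)
    moreover have "Q (y + z) + Q (y - z) = 2 *\<^sub>R Q y + 2 *\<^sub>R Q z" by (rule par)
    ultimately have "2 *\<^sub>R Q (x + y + z) =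
        2 *\<^sub>R (Q (x + y) + Q (x + z) + Q (y + z) - Q x - Q y - Q z)"
      unfolding vec_eq_iff by (simp, smt (verit))
    then show ?thesis by simp
  qed
  \<comment> \<open>0 is the least element of the cone, and F is an order isomorphism.\<close>
  have F0: "F 0 = 0"
  proof -
    obtain Z where Z: "Z \<in> psd" "F Z = 0" using Fsurj[of 0] by auto
    have "0 \<preceq> Z" using Z by (simp add: loewner_le_def)
    then have "F 0 \<preceq> 0" using order[of 0 Z] Z by simp
    moreover have "0 \<preceq> F 0" using Fpsd[of 0] by (simp add: loewner_le_def)
    ultimately show ?thesis by (rule loewner_le_antisym)
  qed
  have Q0: "x = 0" if "Q x = 0" for x
  proof -
    have "F (outer x x) = F 0" using that F0 by (simp add: Q_def)
    then have "outer x x = 0" using inj_onD[OF Finj _ psd_outer psd_zero] by blast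
    then show ?thesis by (simp add: outer_eq_0_iff)
  qed
  obtain k :: 'n where True by simp
  define x0 :: "real^'n" where "x0 = axis k 1"
  have "x0 \<noteq> 0" by (simp add: x0_def)
  define u where "u = t x0"
  have "u \<noteq> 0" using Q0[of x0] \<open>x0 \<noteq> 0\<close> by (auto simp: Qt u_def)
  then have uu: "u \<bullet> u \<noteq> 0" by simp
  \<comment> \<open>The polarisation of Q against the fixed vector \<open>x0\<close>. It is additive
    in x by \<open>JvN\<close>, and it equals u w^T + w u^T where w is one of the two vectors with
    \<open>Q x\<close> = w w^T; thus it determines the sign of w relative to u.\<close>
  define M where "M x = Q (x0 + x) - Q x0 - Q x" for x
  \<comment> \<open>Solves X = u w^T + w u^T for w: here X u = (u . w) u + (u . u) w and u . X u = 2
    (u . u)(u . w).\<close>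
  define dir where "dir X = inverse (u \<bullet> u) *\<^sub>R (X *v u - (inverse (2 * (u \<bullet> u)) * (u \<bullet> (X *v u))) *\<^sub>R u)" for X
  have dir: "dir (outer u w + outer w u) = w" for w
    using uu by (simp add: dir_def matrix_vector_mult_add_rdistrib outer_vector_mult inner_add_right
        inner_commute mult.assoc[symmetric])
  \<comment> \<open>The endpoint that equals \<open>Q (x0 + x)\<close> decides between
    \<open>t x\<close> and \<open>- t x\<close>.\<close>
  have ex: "\<exists>w. Q x = outer w w \<and> M x = outer u w + outer w u" for x
  proof -
    have "Q (x0 + x) = outer (u - t x) (u - t x) \<or> Q (x0 + x) = outer (u + t x) (u + t x)"
      using ends[of x0 x] by (auto simp: u_def doubleton_eq_iff)
    then show ?thesis
    proof
      assume "Q (x0 + x) = outer (u - t x) (u - t x)"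
      then show ?thesis
        by (intro exI[of _ "- t x"]) (simp add: M_def Qt u_def outer_diff_left outer_diff_right
            outer_minus_left outer_minus_right)
    next
      assume "Q (x0 + x) = outer (u + t x) (u + t x)"
      then show ?thesis
        by (intro exI[of _ "t x"]) (simp add: M_def Qt u_def outer_add_left outer_add_right)
    qed
  qed
  define L where "L x = dir (M x)" for x
  have QL: "Q x = outer (L x) (L x)" for x
    using ex[of x] dir unfolding L_def by metis
  have Madd: "M (x + y) = M x + M y" for x y
    using JvN[of x0 x y] unfolding M_def by (simp add: add.assoc)
  have Ladd: "L (x + y) = L x + L y" for x y
    unfolding L_def Madd dir_def
    by (simp add: matrix_vector_mult_add_rdistrib inner_add_right algebra_simps)
  have Qcont: "continuous_on UNIV Q"
    unfolding Q_def by (rule continuous_on_compose2[OF cont]) (auto intro!: continuous_intros psd_outer)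
  have "continuous_on UNIV L"
    unfolding L_def dir_def M_def
    by (intro continuous_intros continuous_on_compose2[OF Qcont]) auto
  then have "linear L" using Ladd by (intro additive_continuous_imp_linear)
  define a where "a = matrix L"
  have aL: "a *v x = L x" for x using \<open>linear L\<close> by (simp add: a_def matrix_works)
  have inv: "invertible a"
  proof (rule invertible_if_kernel_trivial)
    fix x assume "a *v x = 0"
    then have "Q x = 0" by (simp add: QL aL)
    then show "x = 0" by (rule Q0)
  qed
  define b where "b = matrix_inv a"
  have b: "a ** b = mat 1" "b ** a = mat 1" unfolding b_def using invertible_matrix_inv[OF inv] by auto
  have Fouter: "F (outer x x) = outer (a *v x) (a *v x)" for x using QL[of x] by (simp add: Q_def aL)
  have "F R = a ** R ** transpose a" if R: "R \<in> psd" for R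
  proof -
    have bR: "b ** (a ** R ** transpose a) ** transpose b = R"
    proof -
      have "b ** (a ** R ** transpose a) ** transpose b = (b ** a) ** R ** transpose (b ** a)"
        by (simp only: matrix_transpose_mul matrix_mul_assoc)
      then show ?thesis by (simp add: b)
    qed
    have y: "outer y y = outer (a *v (b *v y)) (a *v (b *v y))" for y
      by (simp add: matrix_vector_mul_assoc b)
    \<comment> \<open>F and the congruence by a agree on rank-one matrices and both preserve the
      order in both directions, so the same rank-one matrices lie below the two images of R.\<close>
    have "outer y y \<preceq> F R \<longleftrightarrow> outer y y \<preceq> a ** R ** transpose a" for y
    proof -
      have "outer y y \<preceq> F R \<longleftrightarrow> outer (b *v y) (b *v y) \<preceq> R"
        using order[OF psd_outer R, of "b *v y"] unfolding Fouter y[symmetric] by simp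
      also have "\<dots> \<longleftrightarrow> outer y y \<preceq> a ** R ** transpose a"
        using congruence_loewner_le[of "outer (b *v y) (b *v y)" R a]
          congruence_loewner_le[of "outer y y" "a ** R ** transpose a" b]
        unfolding bR congruence_outer y[symmetric] by blast
      finally show ?thesis .
    qed
    then show ?thesis
      using psd_le_by_rank_one Fpsd[OF R] psd_congruence[OF R, of a] loewner_le_antisym by metis
  qed
  then show thesis using that inv by blast
qed

section \<open>Lebesgue measure on spaces of vectors\<close>

lemma prod_Basis_vec:
  "(\<Prod>b\<in>(Basis :: ('b::euclidean_space^'n) set). g b) = (\<Prod>i\<in>UNIV. \<Prod>e\<in>Basis. g (axis i e))"
proof -
  have inj: "inj_on (\<lambda>(i::'n, e::'b). axis i e) (UNIV \<times> Basis)"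
    by (auto simp: inj_on_def axis_eq_axis)
  have "(Basis :: ('b^'n) set) = (\<lambda>(i, e). axis i e) ` (UNIV \<times> Basis)"
    by (auto simp: Basis_vec_def)
  then have "prod g (Basis :: ('b^'n) set) = (\<Prod>(i, e)\<in>UNIV \<times> Basis. g (axis i e))"
    using prod.reindex[OF inj, of g] by (simp add: case_prod_unfold o_def)
  then show ?thesis by (simp add: prod.cartesian_product)
qed

lemma measurable_vec_lambda:
  "(\<lambda>f. \<chi> i. f i) \<in> PiM (UNIV :: 'n set) (\<lambda>_. lborel :: 'b::euclidean_space measure) \<rightarrow>\<^sub>M (borel :: ('b^'n) measure)"
proof (subst borel_measurable_euclidean_space, intro ballI)
  fix b :: "'b^'n" assume "b \<in> Basis"
  then obtain i e where b: "b = axis i e" by (auto simp: Basis_vec_def)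
  have "(\<lambda>f. f i \<bullet> e) \<in> borel_measurable (PiM (UNIV :: 'n set) (\<lambda>_. lborel :: 'b measure))"
    by (intro borel_measurable_inner borel_measurable_const) measurable
  then show "(\<lambda>f. (\<chi> i. f i) \<bullet> b) \<in> borel_measurable (PiM (UNIV :: 'n set) (\<lambda>_. lborel :: 'b measure))"
    by (simp add: b inner_axis)
qed

text \<open>Fubini for the coordinates of a vector. The entries may be vectors themselves; with
  \<open>'b\<close> = \<open>real^'n\<close> the coordinates are the rows of a matrix.\<close>

lemma lborel_vec:
  "(lborel :: ('b::euclidean_space^'n) measure) =
    distr (PiM UNIV (\<lambda>_. lborel :: 'b measure)) borel (\<lambda>f. \<chi> i. f i)"
proof (rule lborel_eqI)
  interpret product_sigma_finite "\<lambda>_::'n. lborel :: 'b measure"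
    by standard
  fix l u :: "'b^'n" assume le: "\<And>b. b \<in> Basis \<Longrightarrow> l \<bullet> b \<le> u \<bullet> b"
  have le': "l $ i \<bullet> e \<le> u $ i \<bullet> e" if "e \<in> Basis" for i e
    using le[of "axis i e"] that by (auto simp: inner_axis Basis_vec_def)
  let ?P = "PiM UNIV (\<lambda>_::'n. lborel :: 'b measure)"
  have "(\<lambda>f. \<chi> i. f i) -` box l u \<inter> space ?P = Pi\<^sub>E UNIV (\<lambda>i. box (l $ i) (u $ i))"
    by (force simp: mem_box Basis_vec_def inner_axis space_PiM PiE_def Pi_def)
  then have "emeasure (distr ?P borel (\<lambda>f. \<chi> i. f i)) (box l u)
      = emeasure ?P (Pi\<^sub>E UNIV (\<lambda>i. box (l $ i) (u $ i)))"
    by (simp add: emeasure_distr[OF measurable_vec_lambda])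
  also have "\<dots> = (\<Prod>i\<in>UNIV. emeasure lborel (box (l $ i) (u $ i)))"
    by (rule emeasure_PiM) auto
  also have "\<dots> = (\<Prod>i\<in>UNIV. ennreal (\<Prod>e\<in>Basis. (u $ i - l $ i) \<bullet> e))"
    using le' by (intro prod.cong refl emeasure_lborel_box)
  also have "\<dots> = ennreal (\<Prod>b\<in>Basis. (u - l) \<bullet> b)"
    unfolding prod_Basis_vec using le'
    by (subst prod_ennreal) (auto intro!: prod_nonneg simp: inner_axis inner_diff_left)
  finally show "emeasure (distr ?P borel (\<lambda>f. \<chi> i. f i)) (box l u) = ennreal (\<Prod>b\<in>Basis. (u - l) \<bullet> b)" .
qed simp

lemma nn_integral_lborel_vec:
  assumes "f \<in> borel_measurable borel"
  shows "(\<integral>\<^sup>+ v. f v \<partial>(lborel :: ('b::euclidean_space^'n) measure)) =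
    (\<integral>\<^sup>+ x. f (\<chi> i. x i) \<partial>PiM UNIV (\<lambda>_. lborel))"
  by (subst lborel_vec) (simp add: nn_integral_distr[OF measurable_vec_lambda] assms)

lemma nn_integral_lborel_add:
  fixes t :: "'b::euclidean_space"
  assumes [measurable]: "f \<in> borel_measurable borel"
  shows "(\<integral>\<^sup>+ x. f (x + t) \<partial>lborel) = (\<integral>\<^sup>+ x. f x \<partial>lborel)"
proof -
  have "(\<integral>\<^sup>+ x. f x \<partial>lborel) = (\<integral>\<^sup>+ x. f x \<partial>distr lborel borel ((+) t))"
    by (simp add: lborel_distr_plus)
  also have "\<dots> = (\<integral>\<^sup>+ x. f (x + t) \<partial>lborel)"
    by (subst nn_integral_distr) (simp_all add: add.commute)
  finally show ?thesis ..
qed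

text \<open>One operation for both A x, with \<open>'b\<close> = \<open>real\<close>, and A v for a
  matrix v, with \<open>'b\<close> = \<open>real^'n\<close>, so that a single change of variables
  serves the two cases.\<close>

definition vec_action :: "real^'n^'n \<Rightarrow> 'b::euclidean_space^'n \<Rightarrow> 'b^'n" where
  "vec_action A v = (\<chi> i. \<Sum>j\<in>UNIV. A $ i $ j *\<^sub>R v $ j)"

lemma vec_action_matrix_vector: "vec_action A v = A *v v"
  by (simp add: vec_action_def matrix_vector_mult_def)

lemma vec_action_matrix_mult: "vec_action A v = A ** v"
  by (simp add: vec_action_def matrix_matrix_mult_def vec_eq_iff)

lemma vec_action_mult: "vec_action (A ** B) v = vec_action A (vec_action B v)"
proof -
  have "(\<Sum>j\<in>UNIV. (\<Sum>k\<in>UNIV. A $ i $ k * B $ k $ j) *\<^sub>R v $ j)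
      = (\<Sum>k\<in>UNIV. A $ i $ k *\<^sub>R (\<Sum>j\<in>UNIV. B $ k $ j *\<^sub>R v $ j))" for i
    unfolding scaleR_sum_left scaleR_sum_right scaleR_scaleR by (rule sum.swap)
  then show ?thesis by (simp add: vec_action_def matrix_matrix_mult_def vec_eq_iff)
qed

lemma continuous_on_vec_action: "continuous_on UNIV (vec_action A)"
  unfolding vec_action_def by (intro continuous_intros)

lemma measurable_vec_action [measurable]: "vec_action A \<in> borel_measurable borel"
  by (intro borel_measurable_continuous_onI continuous_on_vec_action)

lemma nn_integral_vec_permute:
  fixes p :: "'n::finite \<Rightarrow> 'n"
  assumes [measurable]: "f \<in> borel_measurable borel" and p: "bij p"
  shows "(\<integral>\<^sup>+ v. f (\<chi> i. v $ p i) \<partial>(lborel :: ('b::euclidean_space^'n) measure)) = (\<integral>\<^sup>+ v. f v \<partial>lborel)"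
proof -
  let ?h = "\<lambda>v::'b^'n. \<chi> i. v $ p i"
  have h [measurable]: "?h \<in> borel_measurable borel"
    by (intro borel_measurable_continuous_onI continuous_intros)
  have "(lborel :: ('b^'n) measure) = distr lborel borel ?h"
  proof (rule lborel_eqI)
    fix l u :: "'b^'n" assume le: "\<And>b. b \<in> Basis \<Longrightarrow> l \<bullet> b \<le> u \<bullet> b"
    have le': "l $ i \<bullet> e \<le> u $ i \<bullet> e" if "e \<in> Basis" for i e
      using le[of "axis i e"] that by (auto simp: inner_axis Basis_vec_def)
    let ?q = "inv p"
    have pq: "p (?q i) = i" "?q (p i) = i" for i
      using p by (auto simp: bij_is_surj bij_is_inj surj_f_inv_f)
    have "?h -` box l u = box (\<chi> i. l $ ?q i) (\<chi> i. u $ ?q i)"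
      by (auto simp: mem_box Basis_vec_def inner_axis) (metis pq)+
    then have "emeasure (distr lborel borel ?h) (box l u) = emeasure lborel (box (\<chi> i. l $ ?q i) (\<chi> i. u $ ?q i))"
      by (simp add: emeasure_distr)
    also have "\<dots> = ennreal (\<Prod>b\<in>Basis. ((\<chi> i. u $ ?q i) - (\<chi> i. l $ ?q i)) \<bullet> b)"
      using le' by (intro emeasure_lborel_box) (auto simp: inner_axis Basis_vec_def)
    also have "(\<Prod>b\<in>Basis. ((\<chi> i. u $ ?q i) - (\<chi> i. l $ ?q i)) \<bullet> b)
        = (\<Prod>i\<in>UNIV. \<Prod>e\<in>Basis. (u $ ?q i - l $ ?q i) \<bullet> e)"
      by (simp add: prod_Basis_vec inner_axis)
    also have "\<dots> = (\<Prod>i\<in>UNIV. \<Prod>e\<in>Basis. (u $ i - l $ i) \<bullet> e)"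
      using prod.reindex_bij_betw[OF bij_imp_bij_inv[OF p], of "\<lambda>i. \<Prod>e\<in>Basis. (u $ i - l $ i) \<bullet> e"] .
    also have "\<dots> = (\<Prod>b\<in>Basis. (u - l) \<bullet> b)"
      by (simp add: prod_Basis_vec inner_axis)
    finally show "emeasure (distr lborel borel ?h) (box l u) = ennreal (\<Prod>b\<in>Basis. (u - l) \<bullet> b)" .
  qed simp
  then have "(\<integral>\<^sup>+ v. f v \<partial>lborel) = (\<integral>\<^sup>+ v. f v \<partial>distr lborel borel ?h)" by simp
  also have "\<dots> = (\<integral>\<^sup>+ v. f (?h v) \<partial>lborel)" by (rule nn_integral_distr) simp_all
  finally show ?thesis ..
qed

text \<open>With the other coordinates fixed, the shear is a translation of coordinate m.\<close>

lemma nn_integral_vec_shear: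
  assumes [measurable]: "f \<in> borel_measurable borel" and mn: "m \<noteq> n"
  shows "(\<integral>\<^sup>+ v. f (\<chi> i. if i = m then v $ m + c *\<^sub>R v $ n else v $ i) \<partial>(lborel :: ('b::euclidean_space^'n) measure))
    = (\<integral>\<^sup>+ v. f v \<partial>lborel)"
proof -
  interpret product_sigma_finite "\<lambda>_::'n. lborel :: 'b measure"
    by standard
  let ?s = "\<lambda>v::'b^'n. \<chi> i. if i = m then v $ m + c *\<^sub>R v $ n else v $ i"
  have s [measurable]: "?s \<in> borel_measurable borel"
  proof (intro borel_measurable_continuous_onI continuous_on_vec_lambda)
    show "continuous_on UNIV (\<lambda>v::'b^'n. if i = m then v $ m + c *\<^sub>R v $ n else v $ i)" for i
      by (cases "i = m") (auto intro!: continuous_intros)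
  qed
  let ?I = "UNIV - {m}"
  have U: "insert m ?I = UNIV" by auto
  have ins: "(\<integral>\<^sup>+ v. g v \<partial>lborel)
      = (\<integral>\<^sup>+ x. (\<integral>\<^sup>+ y. g (\<chi> i. (x(m := y)) i) \<partial>lborel) \<partial>PiM ?I (\<lambda>_. lborel))"
    if g: "g \<in> borel_measurable borel" for g :: "'b^'n \<Rightarrow> ennreal"
  proof -
    have "(\<lambda>x. g (\<chi> i. x i)) \<in> borel_measurable (PiM (insert m ?I) (\<lambda>_. lborel))"
      unfolding U by (rule measurable_compose[OF measurable_vec_lambda g])
    from product_nn_integral_insert[OF _ _ this] show ?thesis
      unfolding nn_integral_lborel_vec[OF g] U by simp
  qed
  have "(\<integral>\<^sup>+ v. f (?s v) \<partial>lborel)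
      = (\<integral>\<^sup>+ x. (\<integral>\<^sup>+ y. f (?s (\<chi> i. (x(m := y)) i)) \<partial>lborel) \<partial>PiM ?I (\<lambda>_. lborel))"
    by (rule ins) measurable
  also have "\<dots> = (\<integral>\<^sup>+ x. (\<integral>\<^sup>+ y. f (\<chi> i. (x(m := y)) i) \<partial>lborel) \<partial>PiM ?I (\<lambda>_. lborel))"
  proof (rule nn_integral_cong)
    fix x :: "'n \<Rightarrow> 'b"
    have m: "(\<lambda>y. \<chi> i. (x(m := y)) i) \<in> borel_measurable borel"
      proof (intro borel_measurable_continuous_onI continuous_on_vec_lambda)
      show "continuous_on UNIV (\<lambda>y. (x(m := y)) i)" for i
        by (cases "i = m") (auto intro!: continuous_intros)
    qed
    have "?s (\<chi> i. (x(m := y)) i) = (\<chi> i. (x(m := y + c *\<^sub>R x n)) i)" for y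
      using mn by (simp add: vec_eq_iff)
    then show "(\<integral>\<^sup>+ y. f (?s (\<chi> i. (x(m := y)) i)) \<partial>lborel) = (\<integral>\<^sup>+ y. f (\<chi> i. (x(m := y)) i) \<partial>lborel)"
      using nn_integral_lborel_add[OF measurable_compose[OF m assms(1)], of "c *\<^sub>R x n"] by simp
  qed
  also have "\<dots> = (\<integral>\<^sup>+ v. f v \<partial>lborel)" by (rule ins[symmetric]) measurable
  finally show ?thesis .
qed

lemma nn_integral_vec_diagonal:
  fixes c :: "'n::finite \<Rightarrow> real"
  assumes [measurable]: "f \<in> borel_measurable borel" and c: "\<And>i. c i \<noteq> 0"
  shows "(\<integral>\<^sup>+ v. f (\<chi> i. c i *\<^sub>R v $ i) \<partial>(lborel :: ('b::euclidean_space^'n) measure))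
      * ennreal (\<bar>\<Prod>i\<in>UNIV. c i\<bar> ^ DIM('b)) = (\<integral>\<^sup>+ v. f v \<partial>lborel)"
proof -
  \<comment> \<open>The affine rule for \<open>lborel\<close> asks for one scale per basis vector;
    this sum reads off \<open>c i\<close> from \<open>axis i e\<close>, whose only nonzero entry has
    norm 1.\<close>
  define C where "C b = (\<Sum>i\<in>UNIV. c i * norm (b $ i))" for b :: "'b^'n"
  have C: "C (axis i e) = c i" if "e \<in> Basis" for i e
  proof -
    have "C (axis i e) = (\<Sum>k\<in>UNIV. if k = i then c i else 0)"
      unfolding C_def by (rule sum.cong) (auto simp: axis_def that)
    then show ?thesis by simp
  qed
  have Cnz: "C b \<noteq> 0" if "b \<in> Basis" for b
    using that C c by (auto simp: Basis_vec_def)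
  let ?h = "\<lambda>v::'b^'n. \<chi> i. c i *\<^sub>R v $ i"
  have h [measurable]: "?h \<in> borel_measurable borel"
    by (intro borel_measurable_continuous_onI continuous_intros)
  have T: "0 + (\<Sum>j\<in>Basis. (C j * (v \<bullet> j)) *\<^sub>R j) = ?h v" for v
  proof (rule euclidean_eqI)
    fix b :: "'b^'n" assume b: "b \<in> Basis"
    then obtain i e where e: "b = axis i e" "e \<in> Basis" by (auto simp: Basis_vec_def)
    have "(0 + (\<Sum>j\<in>Basis. (C j * (v \<bullet> j)) *\<^sub>R j)) \<bullet> b = C b * (v \<bullet> b)"
      using b by simp
    also have "\<dots> = ?h v \<bullet> b" using e by (simp add: C inner_axis)
    finally show "(0 + (\<Sum>j\<in>Basis. (C j * (v \<bullet> j)) *\<^sub>R j)) \<bullet> b = ?h v \<bullet> b" .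
  qed
  have "(\<Prod>j\<in>(Basis :: ('b^'n) set). \<bar>C j\<bar>) = \<bar>\<Prod>i\<in>UNIV. c i\<bar> ^ DIM('b)"
    by (simp add: prod_Basis_vec C abs_prod prod_power_distrib)
  then have "(lborel :: ('b^'n) measure) = density (distr lborel borel ?h) (\<lambda>_. ennreal (\<bar>\<Prod>i\<in>UNIV. c i\<bar> ^ DIM('b)))"
    using lborel_affine_euclidean[of C 0] Cnz unfolding T by simp
  then have "(\<integral>\<^sup>+ v. f v \<partial>lborel)
      = (\<integral>\<^sup>+ v. f v \<partial>density (distr lborel borel ?h) (\<lambda>_. ennreal (\<bar>\<Prod>i\<in>UNIV. c i\<bar> ^ DIM('b))))"
    by simp
  also have "\<dots> = (\<integral>\<^sup>+ v. f (?h v) \<partial>lborel) * ennreal (\<bar>\<Prod>i\<in>UNIV. c i\<bar> ^ DIM('b))"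
    by (simp add: nn_integral_density nn_integral_distr nn_integral_cmult mult.commute)
  finally show ?thesis ..
qed

text \<open>Induction over products of elementary matrices. An entry of dimension
  \<open>DIM('b)\<close> is scaled in that many directions, whence the power of the determinant; it
  is multiplied rather than divided by to stay within \<open>ennreal\<close>.\<close>

lemma nn_integral_vec_action:
  fixes A :: "real^'n^'n"
  assumes "f \<in> borel_measurable borel" "det A \<noteq> 0"
  shows "(\<integral>\<^sup>+ v. f (vec_action A v) \<partial>(lborel :: ('b::euclidean_space^'n) measure)) * ennreal (\<bar>det A\<bar> ^ DIM('b))
    = (\<integral>\<^sup>+ v. f v \<partial>lborel)"
proof -
  \<comment> \<open>The quantifier over f belongs to the induction: for a product A B, the claim for
    B is applied to f composed with the action of A. Singular matrices satisfy P vacuously, which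
    settles the case of a zero row.\<close>
  define P where "P A \<longleftrightarrow> (det A \<noteq> 0 \<longrightarrow> (\<forall>f\<in>borel_measurable borel.
    (\<integral>\<^sup>+ v. f (vec_action A v) \<partial>(lborel :: ('b^'n) measure)) * ennreal (\<bar>det A\<bar> ^ DIM('b))
      = (\<integral>\<^sup>+ v. f v \<partial>lborel)))" for A :: "real^'n^'n"
  have "P A"
  proof (rule induct_matrix_elementary)
    fix A B :: "real^'n^'n" assume PA: "P A" and PB: "P B"
    show "P (A ** B)"
      unfolding P_def
    proof (intro impI ballI)
      fix f :: "'b^'n \<Rightarrow> ennreal" assume f: "f \<in> borel_measurable borel" and "det (A ** B) \<noteq> 0"
      then have d: "det A \<noteq> 0" "det B \<noteq> 0" by (auto simp: det_mul)
      have fA: "(\<lambda>v. f (vec_action A v)) \<in> borel_measurable borel"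
        by (rule measurable_compose[OF measurable_vec_action f])
      have "ennreal (\<bar>det (A ** B)\<bar> ^ DIM('b)) = ennreal (\<bar>det B\<bar> ^ DIM('b)) * ennreal (\<bar>det A\<bar> ^ DIM('b))"
        by (simp add: det_mul abs_mult power_mult_distrib ennreal_mult mult.commute)
      moreover have "(\<integral>\<^sup>+ v. f (vec_action A (vec_action B v)) \<partial>lborel) * ennreal (\<bar>det B\<bar> ^ DIM('b))
          = (\<integral>\<^sup>+ v. f (vec_action A v) \<partial>lborel)"
        using PB[unfolded P_def, rule_format, OF d(2) fA] .
      moreover have "(\<integral>\<^sup>+ v. f (vec_action A v) \<partial>lborel) * ennreal (\<bar>det A\<bar> ^ DIM('b)) = (\<integral>\<^sup>+ v. f v \<partial>lborel)"
        using PA[unfolded P_def, rule_format, OF d(1) f] .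
      ultimately show "(\<integral>\<^sup>+ v. f (vec_action (A ** B) v) \<partial>lborel) * ennreal (\<bar>det (A ** B)\<bar> ^ DIM('b))
          = (\<integral>\<^sup>+ v. f v \<partial>lborel)"
        by (simp add: vec_action_mult mult.assoc[symmetric])
    qed
  next
    fix A :: "real^'n^'n" and i assume "row i A = 0"
    then show "P A" unfolding P_def using det_zero_row(2)[of i A] by simp
  next
    fix A :: "real^'n^'n" assume diag: "\<And>i j. i \<noteq> j \<Longrightarrow> A $ i $ j = 0"
    have d: "det A = (\<Prod>i\<in>UNIV. A $ i $ i)" by (rule det_diagonal[OF diag])
    have "(\<Sum>j\<in>UNIV. A $ i $ j *\<^sub>R v $ j) = A $ i $ i *\<^sub>R v $ i" for v :: "'b^'n" and i
      using diag by (subst sum.remove[of _ i]) (auto intro!: sum.neutral)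
    then have "vec_action A v = (\<chi> i. A $ i $ i *\<^sub>R v $ i)" for v :: "'b^'n"
      by (simp add: vec_action_def)
    then show "P A" unfolding P_def d by (auto intro!: nn_integral_vec_diagonal)
  next
    fix m n :: 'n assume "m \<noteq> n"
    let ?t = "Transposition.transpose m n"
    let ?A = "(\<chi> i j. mat 1 $ i $ ?t j) :: real^'n^'n"
    have "\<bar>det ?A\<bar> = 1"
    proof -
      have "?t permutes UNIV" by (rule permutes_swap_id) auto
      from det_permute_columns[OF this, of "mat 1 :: real^'n^'n"] show ?thesis
        by (simp add: sign_swap_id \<open>m \<noteq> n\<close>)
    qed
    moreover have "vec_action ?A v = (\<chi> i. v $ ?t i)" for v :: "'b^'n"
    proof -
      have "(\<Sum>j\<in>UNIV. ?A $ i $ j *\<^sub>R v $ j) = (\<Sum>j\<in>UNIV. if j = ?t i then v $ j else 0)" for i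
        by (rule sum.cong) (auto simp: mat_def)
      then show ?thesis by (simp add: vec_action_def)
    qed
    ultimately show "P ?A" unfolding P_def by (auto intro!: nn_integral_vec_permute)
  next
    fix m n :: 'n and c :: real assume mn: "m \<noteq> n"
    let ?A = "(\<chi> i j. if i = m \<and> j = n then c else of_bool (i = j)) :: real^'n^'n"
    have "det ?A = 1"
    proof -
      have "?A = (\<chi> k. if k = m then row m (mat 1) + c *s row n (mat 1) else row k (mat 1 :: real^'n^'n))"
        using mn by (auto simp: vec_eq_iff row_def mat_def)
      then show ?thesis using det_row_operation[OF mn, of "mat 1 :: real^'n^'n" c] by simp
    qed
    moreover have "vec_action ?A v = (\<chi> i. if i = m then v $ m + c *\<^sub>R v $ n else v $ i)" for v :: "'b^'n"
    proof -
      have "(\<Sum>j\<in>UNIV. ?A $ i $ j *\<^sub>R v $ j) = (if i = m then v $ m + c *\<^sub>R v $ n else v $ i)" for i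
      proof -
        have "(\<Sum>j\<in>UNIV. ?A $ i $ j *\<^sub>R v $ j)
            = (\<Sum>j\<in>UNIV. (if j = i then v $ i else 0) + (if j = n then if i = m then c *\<^sub>R v $ n else 0 else 0))"
          using mn by (intro sum.cong) auto
        then show ?thesis by (simp add: sum.distrib)
      qed
      then show ?thesis by (simp add: vec_action_def)
    qed
    ultimately show "P ?A" unfolding P_def using mn by (auto intro!: nn_integral_vec_shear)
  qed
  then show ?thesis using assms by (simp add: P_def)
qed

section \<open>Finiteness of the normalizing constant\<close>

lemma continuous_on_det: "continuous_on S (det :: real^'n^'n \<Rightarrow> real)"
  unfolding det_def by (intro continuous_intros)

lemma measurable_det [measurable]: "(det :: real^'n^'n \<Rightarrow> real) \<in> borel_measurable borel"
  by (intro borel_measurable_continuous_onI continuous_on_det)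

lemma pd_mat_psd: "pd_mat A \<Longrightarrow> A \<in> psd"
proof (rule psdI)
  assume pd: "pd_mat A"
  then show "transpose A = A" by (simp add: pd_mat_def)
  show "0 \<le> x \<bullet> (A *v x)" for x
    using pd by (cases "x = 0") (auto simp: pd_mat_def intro: less_imp_le)
qed

lemma pd_mat_iff_sphere:
  "pd_mat A \<longleftrightarrow> transpose A = A \<and> (\<forall>x\<in>sphere 0 1. 0 < x \<bullet> (A *v x))"
  for A :: "real^'n^'n"
proof -
  have "0 < x \<bullet> (A *v x)" if pos: "\<forall>x\<in>sphere 0 1. 0 < x \<bullet> (A *v x)" and x: "x \<noteq> 0" for x
  proof -
    have "x /\<^sub>R norm x \<in> sphere 0 1" using x by simp
    then have "0 < (x /\<^sub>R norm x) \<bullet> (A *v (x /\<^sub>R norm x))" using pos by blast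
    also have "\<dots> = (inverse (norm x))\<^sup>2 * (x \<bullet> (A *v x))"
      by (simp add: matrix_vector_mult_scaleR power2_eq_square)
    finally show ?thesis using x by (simp add: zero_less_mult_iff)
  qed
  moreover have "x \<noteq> 0" if "x \<in> sphere 0 1" for x :: "real^'n" using that by auto
  ultimately show ?thesis unfolding pd_mat_def by blast
qed

text \<open>The complement is the projection of a closed set along the compact sphere, hence
  closed.\<close>

lemma open_positive_on_sphere:
  "open {A :: real^'n^'n. \<forall>x\<in>sphere 0 1. 0 < x \<bullet> (A *v x)}"
proof -
  let ?T = "{p :: (real^'n) \<times> (real^'n^'n). fst p \<bullet> (snd p *v fst p) \<le> 0}"
  have "closed ?T" by (intro closed_Collect_le continuous_intros)
  from closed_compact_projection[OF compact_sphere this, of 0 1]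
  have "closed {A :: real^'n^'n. \<exists>x. x \<in> sphere 0 1 \<and> x \<bullet> (A *v x) \<le> 0}" by simp
  moreover have "{A :: real^'n^'n. \<forall>x\<in>sphere 0 1. 0 < x \<bullet> (A *v x)}
      = - {A. \<exists>x. x \<in> sphere 0 1 \<and> x \<bullet> (A *v x) \<le> 0}"
    by (auto simp only: not_le[symmetric] Compl_iff mem_Collect_eq)
  ultimately show ?thesis by (simp add: open_Compl)
qed

lemma pd_mat_sets [measurable]: "{A :: real^'n^'n. pd_mat A} \<in> sets borel"
proof -
  have "{A :: real^'n^'n. pd_mat A}
      = {A. transpose A = A} \<inter> {A. \<forall>x\<in>sphere 0 1. 0 < x \<bullet> (A *v x)}"
    by (auto simp: pd_mat_iff_sphere)
  moreover have "closed {A :: real^'n^'n. transpose A = A}"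
    by (intro closed_Collect_eq continuous_intros)
  ultimately show ?thesis
    by (simp only:) (intro sets.Int borel_closed borel_open open_positive_on_sphere)
qed

lemma pd_mat_congruence:
  fixes a :: "real^'n^'n"
  assumes "pd_mat A" "invertible a" shows "pd_mat (a ** A ** transpose a)"
  unfolding pd_mat_def
proof (intro conjI allI impI)
  show "transpose (a ** A ** transpose a) = a ** A ** transpose a"
    using assms(1) by (intro psd_symmetric psd_congruence pd_mat_psd)
  fix x :: "real^'n" assume "x \<noteq> 0"
  have "transpose a *v x \<noteq> 0"
    using \<open>x \<noteq> 0\<close> assms(2) transpose_invertible
    by (metis invertible_left_inverse matrix_left_invertible_ker)
  then have "0 < (transpose a *v x) \<bullet> (A *v (transpose a *v x))"
    using assms(1) by (simp add: pd_mat_def)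
  also have "\<dots> = x \<bullet> ((a ** A ** transpose a) *v x)"
    by (simp add: inner_matrix_vector_left matrix_vector_mul_assoc[symmetric])
  finally show "0 < x \<bullet> ((a ** A ** transpose a) *v x)" .
qed

lemma pd_mat_congruence_iff:
  fixes a :: "real^'n^'n"
  assumes "invertible a" shows "pd_mat (a ** A ** transpose a) \<longleftrightarrow> pd_mat A"
proof
  assume pd: "pd_mat (a ** A ** transpose a)"
  let ?b = "matrix_inv a"
  have b: "?b ** a = mat 1" "a ** ?b = mat 1" using invertible_matrix_inv[OF assms] by auto
  then have "invertible ?b" unfolding invertible_def by blast
  from pd_mat_congruence[OF pd this]
  have "pd_mat (?b ** (a ** A ** transpose a) ** transpose ?b)" .
  also have "?b ** (a ** A ** transpose a) ** transpose ?b = (?b ** a) ** A ** transpose (?b ** a)"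
    by (simp only: matrix_transpose_mul matrix_mul_assoc)
  finally show "pd_mat A" by (simp add: b)
qed (rule pd_mat_congruence[OF _ assms])

lemma pd_mat_msqrt:
  assumes "pd_mat A"
  shows "invertible (msqrt A)" "det (msqrt A) \<noteq> 0" "det A = (det (msqrt A))\<^sup>2" "0 < det A"
proof -
  note A = pd_mat_psd[OF assms]
  show inv: "invertible (msqrt A)"
  proof (rule invertible_if_kernel_trivial)
    fix x assume "msqrt A *v x = 0"
    then have "A *v x = 0"
      by (metis A matrix_vector_mul_assoc matrix_vector_mult_0_right msqrt_square)
    then show "x = 0" using assms unfolding pd_mat_def by (metis inner_zero_right less_irrefl)
  qed
  then show d: "det (msqrt A) \<noteq> 0" by (simp add: invertible_det_nz)
  show "det A = (det (msqrt A))\<^sup>2" by (metis A det_mul msqrt_square power2_eq_square)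
  then show "0 < det A" using d by simp
qed

lemma pd_mat_one_minus_outer: "pd_mat (mat 1 - outer u u) \<longleftrightarrow> norm u < 1"
proof
  assume pd: "pd_mat (mat 1 - outer u u)"
  show "norm u < 1"
  proof (cases "u = 0")
    case False
    have "0 < u \<bullet> ((mat 1 - outer u u) *v u)" using pd False by (simp add: pd_mat_def)
    also have "\<dots> = (norm u)\<^sup>2 * (1 - (norm u)\<^sup>2)"
      by (simp add: matrix_vector_mult_diff_rdistrib inner_diff_right outer_vector_mult power2_norm_eq_inner
          algebra_simps)
    finally have "(norm u)\<^sup>2 < 1" using False by (simp add: zero_less_mult_iff)
    then show ?thesis by (simp add: abs_square_less_1)
  qed simp
next
  assume u: "norm u < 1"
  show "pd_mat (mat 1 - outer u u)"
    unfolding pd_mat_def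
  proof (intro conjI allI impI)
    show "transpose (mat 1 - outer u u) = mat 1 - outer u u" by (simp add: transpose_diff transpose_outer)
    fix x :: "real^'a" assume x: "x \<noteq> 0"
    have "(u \<bullet> x)\<^sup>2 \<le> (norm u)\<^sup>2 * (norm x)\<^sup>2"
      by (metis Cauchy_Schwarz_ineq power2_norm_eq_inner)
    also have "\<dots> < 1 * (norm x)\<^sup>2"
      using u x by (intro mult_strict_right_mono) (simp_all add: abs_square_less_1)
    finally show "0 < x \<bullet> ((mat 1 - outer u u) *v x)"
      by (simp add: matrix_vector_mult_diff_rdistrib inner_diff_right outer_form power2_norm_eq_inner)
  qed
qed

text \<open>Rotating u onto a coordinate axis makes the matrix diagonal.\<close>

lemma det_one_minus_outer: "det (mat 1 - outer u u) = 1 - (norm u)\<^sup>2"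
  for u :: "real^'n"
proof -
  obtain k :: 'n where True by simp
  let ?e = "norm u *\<^sub>R axis k 1 :: real^'n"
  have "norm ?e = norm u" by simp
  then obtain f where f: "orthogonal_transformation f" "f ?e = u"
    using orthogonal_transformation_exists by blast
  define U where "U = matrix f"
  have lin: "linear f" using f(1) by (rule orthogonal_transformation_linear)
  have Ue: "U *v ?e = u" using f(2) lin by (simp add: U_def)
  have orth: "U ** transpose U = mat 1"
    using f(1) unfolding U_def orthogonal_transformation_matrix orthogonal_matrix_def by blast
  then have dU: "det U * det U = 1" by (metis det_I det_mul det_transpose)
  let ?D = "mat 1 - outer ?e ?e"
  have "mat 1 - outer u u = U ** ?D ** transpose U"
    by (simp only: matrix_sub_ldistrib matrix_sub_rdistrib matrix_mul_rid orth congruence_outer Ue)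
  then have "det (mat 1 - outer u u) = det ?D" using dU by (simp add: det_mul mult_ac)
  also have "\<dots> = (\<Prod>i\<in>UNIV. ?D $ i $ i)"
    by (rule det_diagonal) (auto simp: mat_def outer_def axis_def)
  also have "\<dots> = (\<Prod>i\<in>UNIV. if i = k then 1 - (norm u)\<^sup>2 else 1)"
    by (rule prod.cong) (auto simp: mat_def outer_def axis_def power2_eq_square)
  also have "\<dots> = 1 - (norm u)\<^sup>2" by simp
  finally show ?thesis .
qed

section \<open>The weight on the Euclidean ball\<close>

lemma one_minus_power_le: "1 - (1 - x) ^ n \<le> real n * x" if "0 \<le> x" "x \<le> 1" for x :: real
  using Bernoulli_inequality[of "- x" n] that by simp

lemma ball_shell_measure:
  fixes e :: real
  assumes e: "0 \<le> e" "e \<le> 1"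
  shows "emeasure lborel {u :: 'a::euclidean_space. 1 - e \<le> norm u \<and> norm u < 1}
    \<le> ennreal (unit_ball_vol (real DIM('a)) * real DIM('a) * e)"
proof -
  let ?V = "unit_ball_vol (real DIM('a))"
  have eq: "{u :: 'a. 1 - e \<le> norm u \<and> norm u < 1} = ball 0 1 - ball 0 (1 - e)" by auto
  have "emeasure lborel (ball (0::'a) 1 - ball 0 (1 - e))
      = emeasure lborel (ball (0::'a) 1) - emeasure lborel (ball (0::'a) (1 - e))"
    using e by (intro emeasure_Diff) (auto simp: emeasure_ball)
  also have "\<dots> = ennreal (?V * 1 ^ DIM('a)) - ennreal (?V * (1 - e) ^ DIM('a))"
    using e by (simp add: emeasure_ball)
  also have "\<dots> = ennreal (?V * (1 - (1 - e) ^ DIM('a)))"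
    using e by (subst ennreal_minus) (simp_all add: algebra_simps)
  also have "\<dots> \<le> ennreal (?V * (real DIM('a) * e))"
    using e by (intro ennreal_leI mult_left_mono one_minus_power_le) simp_all
  finally show ?thesis unfolding eq by (simp add: mult.assoc)
qed

text \<open>Dyadic shells: where 1 - |u| is about 2^-k the weight is at most 2^(-(k+1) b), while the
  shell \<open>S k\<close> has volume of order 2^-k. The products form a geometric series of ratio
  2^-(b+1), which is below 1 exactly when b > -1.\<close>

lemma ball_weight_integral_finite_nonpos:
  fixes b :: real
  assumes b: "-1 < b" "b \<le> 0"
  shows "(\<integral>\<^sup>+ u. ennreal ((1 - (norm u)\<^sup>2) powr b) * indicator (ball 0 1) u
    \<partial>(lborel :: 'a::euclidean_space measure)) < \<infinity>"
proof -
  let ?V = "unit_ball_vol (real DIM('a))"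
  define S where "S k = {u :: 'a. 1 - (1/2) ^ k \<le> norm u \<and> norm u < 1}" for k :: nat
  define c where "c k = ((1/2::real) ^ Suc k) powr b" for k :: nat
  have "S k = ball 0 1 - ball 0 (1 - (1/2) ^ k)" for k by (auto simp: S_def)
  then have S [measurable]: "S k \<in> sets borel" for k by simp
  have pw: "ennreal ((1 - (norm u)\<^sup>2) powr b) * indicator (ball 0 1) u
      \<le> (\<Sum>k. ennreal (c k) * indicator (S k) u)" for u :: 'a
  proof (cases "norm u < 1")
    case True
    define d where "d = 1 - norm u"
    have d: "0 < d" "d \<le> 1" using True by (auto simp: d_def)
    obtain n where n: "(1/2::real) ^ n < d" using real_arch_pow_inv[of d "1/2"] d by auto
    \<comment> \<open>The least such k puts d in the interval from 2^-(k+1) to 2^-k: the lower end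
      bounds the weight, the upper end places u in \<open>S k\<close>.\<close>
    define k where "k = (LEAST n. (1/2::real) ^ Suc n < d)"
    have "(1/2::real) ^ Suc n < d" using n d by (simp add: field_simps)
    then have k1: "(1/2::real) ^ Suc k < d" unfolding k_def by (rule LeastI)
    have k2: "d \<le> (1/2) ^ k"
    proof (cases k)
      case 0
      then show ?thesis using d by simp
    next
      case (Suc j)
      then have "\<not> (1/2::real) ^ Suc j < d" using not_less_Least[of j "\<lambda>n. (1/2::real) ^ Suc n < d"]
        by (simp add: k_def)
      then show ?thesis using Suc by simp
    qed
    have "u \<in> S k" using k2 True by (auto simp: S_def d_def)
    have "(norm u)\<^sup>2 \<le> norm u" using True by (simp add: power2_eq_square mult_left_le)
    then have "(1/2::real) ^ Suc k \<le> 1 - (norm u)\<^sup>2" using k1 by (simp add: d_def)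
    then have "(1 - (norm u)\<^sup>2) powr b \<le> c k"
      unfolding c_def using b by (intro powr_mono2') auto
    then have "ennreal ((1 - (norm u)\<^sup>2) powr b) * indicator (ball 0 1) u \<le> ennreal (c k) * indicator (S k) u"
      using \<open>u \<in> S k\<close> True by (simp add: ennreal_leI)
    also have "\<dots> \<le> (\<Sum>k. ennreal (c k) * indicator (S k) u)"
      using sum_le_suminf[of "\<lambda>k. ennreal (c k) * indicator (S k) u" "{k}", OF summableI]
      by (simp del: sum_mult_indicator)
    finally show ?thesis .
  qed simp
  define q where "q = (1/2::real) powr (b + 1)"
  have q: "0 \<le> q" "q < 1" unfolding q_def using b by (auto simp: powr_def mult_pos_neg)
  have cq: "c k * (?V * real DIM('a) * (1/2) ^ k) = (1/2) powr b * ?V * real DIM('a) * q ^ k" for k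
  proof -
    have "c k = (1/2) powr b * ((1/2) powr b) ^ k"
    proof -
      have "((1/2::real) ^ k) powr b = ((1/2) powr b) ^ k"
        using powr_powr[of "1/2::real" "real k" b] powr_powr[of "1/2::real" b "real k"]
        by (simp add: powr_realpow mult.commute)
      then show ?thesis unfolding c_def power_Suc by (subst powr_mult) simp_all
    qed
    moreover have "((1/2::real) powr b) ^ k * (1/2) ^ k = q ^ k"
      by (simp add: q_def powr_add power_mult_distrib[symmetric])
    ultimately show ?thesis by (simp add: mult_ac)
  qed
  have "(\<integral>\<^sup>+ u. ennreal ((1 - (norm u)\<^sup>2) powr b) * indicator (ball 0 1) u \<partial>(lborel :: 'a measure))
      \<le> (\<integral>\<^sup>+ u. (\<Sum>k. ennreal (c k) * indicator (S k) u) \<partial>lborel)"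
    by (intro nn_integral_mono pw)
  also have "\<dots> = (\<Sum>k. \<integral>\<^sup>+ u. ennreal (c k) * indicator (S k) u \<partial>lborel)"
    by (rule nn_integral_suminf) measurable
  also have "\<dots> = (\<Sum>k. ennreal (c k) * emeasure lborel (S k))"
    by (simp add: nn_integral_cmult)
  also have "\<dots> \<le> (\<Sum>k. ennreal ((1/2) powr b * ?V * real DIM('a) * q ^ k))"
  proof (intro suminf_le summableI)
    fix k
    have "ennreal (c k) * emeasure lborel (S k) \<le> ennreal (c k) * ennreal (?V * real DIM('a) * (1/2) ^ k)"
      unfolding S_def by (intro mult_left_mono ball_shell_measure) (auto simp: power_le_one)
    also have "\<dots> = ennreal (c k * (?V * real DIM('a) * (1/2) ^ k))"
      by (rule ennreal_mult[symmetric]) (auto simp: c_def)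
    finally show "ennreal (c k) * emeasure lborel (S k) \<le> ennreal ((1/2) powr b * ?V * real DIM('a) * q ^ k)"
      by (simp only: cq)
  qed
  also have "\<dots> = ennreal (\<Sum>k. (1/2) powr b * ?V * real DIM('a) * q ^ k)"
    using q by (intro suminf_ennreal2 summable_mult summable_geometric) auto
  also have "\<dots> < \<infinity>" by simp
  finally show ?thesis .
qed

text \<open>The base lies in (0, 1] on the ball, so lowering a positive exponent to 0 only increases
  the weight.\<close>

lemma ball_weight_integral_finite:
  fixes b :: real
  assumes "-1 < b"
  shows "(\<integral>\<^sup>+ u. ennreal ((1 - (norm u)\<^sup>2) powr b) * indicator (ball 0 1) u
    \<partial>(lborel :: 'a::euclidean_space measure)) < \<infinity>"
proof -
  have "(\<integral>\<^sup>+ u. ennreal ((1 - (norm u)\<^sup>2) powr b) * indicator (ball 0 1) u \<partial>(lborel :: 'a measure))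
      \<le> (\<integral>\<^sup>+ u. ennreal ((1 - (norm u)\<^sup>2) powr (min b 0)) * indicator (ball 0 1) u \<partial>(lborel :: 'a measure))"
  proof (rule nn_integral_mono)
    fix u :: 'a
    have "(1 - (norm u)\<^sup>2) powr b \<le> (1 - (norm u)\<^sup>2) powr (min b 0)" if "norm u < 1"
      using that by (intro powr_mono') (auto simp: abs_square_le_1 abs_square_less_1)
    then show "ennreal ((1 - (norm u)\<^sup>2) powr b) * indicator (ball 0 1) u
        \<le> ennreal ((1 - (norm u)\<^sup>2) powr (min b 0)) * indicator (ball 0 1) u"
      by (cases "norm u < 1") (auto intro!: ennreal_leI)
  qed
  also have "\<dots> < \<infinity>" using assms by (intro ball_weight_integral_finite_nonpos) auto
  finally show ?thesis .
qed

text \<open>The value 0 off the positive definite cone moves the domain constraint into the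
  integrand, so that integrals run over full product spaces and Fubini applies row by row.\<close>

definition pd_power :: "real \<Rightarrow> real^'n^'n \<Rightarrow> ennreal" where
  "pd_power b A = (if pd_mat A then ennreal (det A powr b) else 0)"

lemma measurable_pd_power [measurable]: "(pd_power b :: real^'n^'n \<Rightarrow> _) \<in> borel_measurable borel"
proof -
  have "(pd_power b :: real^'n^'n \<Rightarrow> _) = (\<lambda>A. ennreal (det A powr b) * indicator {A. pd_mat A} A)"
    by (auto simp: pd_power_def fun_eq_iff)
  then show ?thesis by (simp only:) measurable
qed

lemma pd_power_one_minus_outer:
  "pd_power b (mat 1 - outer u u) = ennreal ((1 - (norm u)\<^sup>2) powr b) * indicator (ball 0 1) u"
  by (simp add: pd_power_def pd_mat_one_minus_outer det_one_minus_outer)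

lemma measurable_outer [measurable]: "(\<lambda>w. outer w w) \<in> borel_measurable borel"
  by (intro borel_measurable_continuous_onI continuous_intros)

text \<open>Substituting \<open>w = A\<^sup>1\<^sup>/\<^sup>2 u\<close> turns \<open>A - w w\<^sup>T\<close> into a congruence of \<open>1 - u u\<^sup>T\<close>; the Jacobian gains half a power
  of the determinant.\<close>

lemma pd_power_rank_one_integral:
  fixes A :: "real^'n^'n"
  assumes A: "pd_mat A"
  shows "(\<integral>\<^sup>+ w. pd_power b (A - outer w w) \<partial>(lborel :: (real^'n) measure))
    = pd_power (b + 1/2) A * (\<integral>\<^sup>+ u. pd_power b (mat 1 - outer u u) \<partial>(lborel :: (real^'n) measure))"
proof -
  let ?s = "msqrt A"
  note s = pd_mat_msqrt[OF A]
  have ssym: "transpose ?s = ?s" by (intro psd_symmetric msqrt_psd pd_mat_psd A)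
  have "pd_power b (A - outer (?s *v u) (?s *v u)) = ennreal (det A powr b) * pd_power b (mat 1 - outer u u)" for u :: "real^'n"
  proof -
    have eq: "A - outer (?s *v u) (?s *v u) = ?s ** (mat 1 - outer u u) ** transpose ?s"
      unfolding matrix_sub_ldistrib matrix_sub_rdistrib congruence_outer
      by (simp add: ssym msqrt_square pd_mat_psd A)
    have "det (A - outer (?s *v u) (?s *v u)) = det A * det (mat 1 - outer u u)"
      unfolding eq s(3) by (simp add: det_mul power2_eq_square)
    moreover have "pd_mat (A - outer (?s *v u) (?s *v u)) \<longleftrightarrow> pd_mat (mat 1 - outer u u)"
      unfolding eq by (rule pd_mat_congruence_iff[OF s(1)])
    ultimately show ?thesis
      using s(4) pd_mat_msqrt(4)[of "mat 1 - outer u u"]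
      by (auto simp: pd_power_def powr_mult ennreal_mult)
  qed
  then have "(\<integral>\<^sup>+ u. pd_power b (A - outer (?s *v u) (?s *v u)) \<partial>(lborel :: (real^'n) measure))
      = (\<integral>\<^sup>+ u. ennreal (det A powr b) * pd_power b (mat 1 - outer u u) \<partial>(lborel :: (real^'n) measure))"
    by (simp only:)
  also have "\<dots> = ennreal (det A powr b) * (\<integral>\<^sup>+ u. pd_power b (mat 1 - outer u u) \<partial>(lborel :: (real^'n) measure))"
    by (rule nn_integral_cmult) measurable
  finally have e1: "(\<integral>\<^sup>+ u. pd_power b (A - outer (?s *v u) (?s *v u)) \<partial>(lborel :: (real^'n) measure))
      = ennreal (det A powr b) * (\<integral>\<^sup>+ u. pd_power b (mat 1 - outer u u) \<partial>(lborel :: (real^'n) measure))" .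
  have e2: "(\<integral>\<^sup>+ w. pd_power b (A - outer w w) \<partial>(lborel :: (real^'n) measure))
      = (\<integral>\<^sup>+ u. pd_power b (A - outer (?s *v u) (?s *v u)) \<partial>(lborel :: (real^'n) measure)) * ennreal \<bar>det ?s\<bar>"
    using nn_integral_vec_action[of "\<lambda>w. pd_power b (A - outer w w)" ?s, OF _ s(2)]
    by (simp add: vec_action_matrix_vector)
  have e3: "ennreal (det A powr b) * ennreal \<bar>det ?s\<bar> = pd_power (b + 1/2) A"
  proof -
    have "det A powr (1/2) = \<bar>det ?s\<bar>" using s(4) by (simp add: powr_half_sqrt s(3))
    then show ?thesis using A by (simp add: pd_power_def powr_add ennreal_mult)
  qed
  show ?thesis unfolding e2 e1 e3[symmetric] by (simp only: mult_ac)
qed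

lemma pd_mat_minus_outer_imp: "pd_mat (A - outer w w) \<Longrightarrow> pd_mat A"
proof -
  assume pd: "pd_mat (A - outer w w)"
  have "transpose A = A"
    using pd by (simp add: pd_mat_def transpose_diff transpose_outer)
  moreover have "0 < x \<bullet> (A *v x)" if "x \<noteq> 0" for x
  proof -
    have "0 < x \<bullet> ((A - outer w w) *v x)" using pd that by (simp add: pd_mat_def)
    also have "\<dots> \<le> x \<bullet> (A *v x)"
      by (simp add: matrix_vector_mult_diff_rdistrib inner_diff_right outer_form)
    finally show ?thesis .
  qed
  ultimately show ?thesis by (simp add: pd_mat_def)
qed

text \<open>Integrating out one row yields a finite constant and raises the exponent by 1/2, so the
  condition -1 < b persists; this is why b is generalised in the induction. For all rows the matrix
  is I - v^T v.\<close>

lemma pd_power_rows_integral_finite: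
  fixes b :: real and S :: "'n::finite set"
  assumes "-1 < b"
  shows "(\<integral>\<^sup>+ x. pd_power b (mat 1 - (\<Sum>i\<in>S. outer (x i) (x i))) \<partial>PiM S (\<lambda>_. lborel :: (real^'n) measure)) < \<infinity>"
proof -
  interpret product_sigma_finite "\<lambda>_::'n. lborel :: (real^'n) measure"
    by standard
  have "finite S" by simp
  then show ?thesis using assms
  proof (induction S arbitrary: b rule: finite_induct)
    case empty
    then show ?case by (subst nn_integral_empty) (simp_all add: pd_power_def)
  next
    case (insert k S)
    let ?B = "\<lambda>x. mat 1 - (\<Sum>i\<in>S. outer (x i) (x i)) :: real^'n^'n"
    let ?C = "\<integral>\<^sup>+ u. pd_power b (mat 1 - outer u u) \<partial>(lborel :: (real^'n) measure)"
    have C: "?C < \<infinity>"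
      using ball_weight_integral_finite[OF insert.prems, where 'a="real^'n"] by (simp add: pd_power_one_minus_outer)
    have meas: "(\<lambda>x. pd_power b (mat 1 - (\<Sum>i\<in>insert k S. outer (x i) (x i))))
        \<in> borel_measurable (PiM (insert k S) (\<lambda>_. lborel :: (real^'n) measure))"
      by measurable
    have "(\<integral>\<^sup>+ x. pd_power b (mat 1 - (\<Sum>i\<in>insert k S. outer (x i) (x i))) \<partial>PiM (insert k S) (\<lambda>_. lborel :: (real^'n) measure))
        = (\<integral>\<^sup>+ x. (\<integral>\<^sup>+ w. pd_power b (?B x - outer w w) \<partial>lborel) \<partial>PiM S (\<lambda>_. lborel))"
    proof (subst product_nn_integral_insert[OF insert.hyps(1,2) meas], intro nn_integral_cong)
      fix x :: "'n \<Rightarrow> real^'n" and w :: "real^'n"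
      have "(\<Sum>i\<in>insert k S. outer ((x(k := w)) i) ((x(k := w)) i)) = outer w w + (\<Sum>i\<in>S. outer (x i) (x i))"
        using insert.hyps by (auto intro!: sum.cong)
      then show "pd_power b (mat 1 - (\<Sum>i\<in>insert k S. outer ((x(k := w)) i) ((x(k := w)) i)))
          = pd_power b (?B x - outer w w)"
        by (simp add: algebra_simps)
    qed
    also have "\<dots> = (\<integral>\<^sup>+ x. pd_power (b + 1/2) (?B x) * ?C \<partial>PiM S (\<lambda>_. lborel))"
    proof (rule nn_integral_cong)
      fix x :: "'n \<Rightarrow> real^'n"
      show "(\<integral>\<^sup>+ w. pd_power b (?B x - outer w w) \<partial>lborel) = pd_power (b + 1/2) (?B x) * ?C"
      proof (cases "pd_mat (?B x)")
        case True
        then show ?thesis by (rule pd_power_rank_one_integral)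
      next
        case False
        then have "pd_power b (?B x - outer w w) = 0" for w
          using pd_mat_minus_outer_imp unfolding pd_power_def by metis
        then show ?thesis using False by (simp add: pd_power_def)
      qed
    qed
    also have "\<dots> = (\<integral>\<^sup>+ x. pd_power (b + 1/2) (?B x) \<partial>PiM S (\<lambda>_. lborel)) * ?C"
      by (rule nn_integral_multc) measurable
    also have "\<dots> < \<infinity>"
      using insert.IH[of "b + 1/2"] insert.prems C by (simp add: ennreal_mult_less_top)
    finally show ?case .
  qed
qed

lemma transpose_mult_self_rows: "transpose v ** v = (\<Sum>i\<in>UNIV. outer (v $ i) (v $ i))"
  for v :: "real^'n^'n"
  by (simp add: vec_eq_iff matrix_matrix_mult_def transpose_def outer_def)

lemma ballD_weight_finite:
  assumes "-1 < b"
  shows "(\<integral>\<^sup>+ v. pd_power b (mat 1 - transpose v ** v) \<partial>(lborel :: (real^'n^'n) measure)) < \<infinity>"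
proof -
  have m: "(\<lambda>v::real^'n^'n. pd_power b (mat 1 - transpose v ** v)) \<in> borel_measurable borel"
    by (intro measurable_compose[OF _ measurable_pd_power] borel_measurable_continuous_onI continuous_intros)
  show ?thesis
    using pd_power_rows_integral_finite[OF assms, where S="UNIV::'n set"]
    unfolding nn_integral_lborel_vec[OF m] by (simp add: transpose_mult_self_rows)
qed

section \<open>The convolution measures\<close>

lemma ballD_iff: "v \<in> ballD \<longleftrightarrow> (\<forall>x. x \<noteq> 0 \<longrightarrow> norm (v *v x) < norm x)"
  for v :: "real^'n^'n"
proof -
  have "x \<bullet> ((mat 1 - transpose v ** v) *v x) = (norm x)\<^sup>2 - (norm (v *v x))\<^sup>2" for x
    by (simp add: matrix_vector_mult_diff_rdistrib inner_diff_right matrix_vector_mul_assoc[symmetric]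
        inner_matrix_vector_left power2_norm_eq_inner)
  moreover have "transpose (mat 1 - transpose v ** v) = mat 1 - transpose v ** v"
    by (simp add: transpose_diff matrix_transpose_mul)
  moreover have "(norm (v *v x))\<^sup>2 < (norm x)\<^sup>2 \<longleftrightarrow> norm (v *v x) < norm x" for x
    using power2_less_imp_less[of "norm (v *v x)" "norm x"] power_strict_mono[of "norm (v *v x)" "norm x" 2]
    by auto
  ultimately show ?thesis
    by (simp add: ballD_def pd_mat_def)
qed

lemma open_ballD: "open (ballD :: (real^'n^'n) set)"
proof -
  have eq: "(ballD :: (real^'n^'n) set) = (\<lambda>v. mat 1 - transpose v ** v) -` {A. \<forall>x\<in>sphere 0 1. 0 < x \<bullet> (A *v x)}"
    by (auto simp: ballD_def pd_mat_iff_sphere transpose_diff matrix_transpose_mul)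
  show ?thesis
    unfolding eq by (intro open_vimage open_positive_on_sphere continuous_intros)
qed

lemma ballD_sets [measurable]: "ballD \<in> sets borel"
  by (intro borel_open open_ballD)

lemma ballD_subset_contractions: "ballD \<subseteq> contractions"
proof
  fix v :: "real^'a^'a" assume "v \<in> ballD"
  then have "norm (v *v x) \<le> norm x" for x
    by (cases "x = 0") (auto simp: ballD_iff intro: less_imp_le)
  then show "v \<in> contractions" by (simp add: contractions_def)
qed

text \<open>Shrinking a contraction by a factor 1 - 1/(k+1) brings it into the open ball.\<close>

lemma contractions_subset_closure_ballD: "contractions \<subseteq> closure ballD"
proof
  fix v :: "real^'a^'a" assume v: "v \<in> contractions"
  define c where "c k = 1 - inverse (real (Suc k))" for k
  have c: "0 \<le> c k" "c k < 1" for k unfolding c_def by (auto simp: field_simps)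
  have "c k *\<^sub>R v \<in> ballD" for k
    unfolding ballD_iff
  proof (intro allI impI)
    fix x :: "real^'a" assume x: "x \<noteq> 0"
    have "norm ((c k *\<^sub>R v) *v x) = c k * norm (v *v x)" using c by (simp add: scaleR_matrix_vector)
    also have "\<dots> \<le> c k * norm x" using c by (intro mult_left_mono contractionsD v)
    also have "\<dots> < 1 * norm x" using c x by (intro mult_strict_right_mono) auto
    finally show "norm ((c k *\<^sub>R v) *v x) < norm x" by simp
  qed
  moreover have "(\<lambda>k. c k *\<^sub>R v) \<longlonglongrightarrow> (1 - 0) *\<^sub>R v"
    unfolding c_def by (intro tendsto_intros LIMSEQ_inverse_real_of_nat)
  ultimately show "v \<in> closure ballD" unfolding closure_sequential by (auto intro!: exI[of _ "\<lambda>k. c k *\<^sub>R v"])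
qed

text \<open>The density uses v v^T while \<open>ballD\<close> uses v^T v. If x = v v^T x, then v
  maps v^T x to a vector at least as long, which \<open>ballD\<close> permits only for v^T x = 0.
  Nonvanishing suffices for the weight, since \<open>powr\<close> is positive at every nonzero
  base.\<close>

lemma det_one_minus_mult_transpose_nz:
  assumes v: "v \<in> ballD" shows "det (mat 1 - v ** transpose v) \<noteq> 0"
proof -
  have "invertible (mat 1 - v ** transpose v)"
  proof (rule invertible_if_kernel_trivial)
    fix x assume "(mat 1 - v ** transpose v) *v x = 0"
    then have x: "x = v *v (transpose v *v x)"
      by (simp add: matrix_vector_mult_diff_rdistrib matrix_vector_mul_assoc[symmetric])
    have "norm (transpose v *v x) \<le> norm x"
      using contractionsD[OF contractions_transpose] ballD_subset_contractions v by blast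
    then have "\<not> norm (v *v (transpose v *v x)) < norm (transpose v *v x)" using x by simp
    then have "transpose v *v x = 0" using v unfolding ballD_iff by blast
    then show "x = 0" using x by simp
  qed
  then show ?thesis by (simp add: invertible_det_nz)
qed

lemma emeasure_lborel_open_nonempty:
  fixes S :: "'a::euclidean_space set"
  assumes "open S" "S \<noteq> {}" shows "emeasure lborel S \<noteq> 0"
proof -
  obtain x e where e: "e > 0" "ball x e \<subseteq> S" using assms by (metis all_not_in_conv openE)
  have "0 < emeasure lborel (ball x e)"
    using e by (simp add: emeasure_ball unit_ball_vol_pos)
  also have "\<dots> \<le> emeasure lborel S" using e assms by (intro emeasure_mono) auto
  finally show ?thesis by simp
qed

text \<open>Finiteness identifies the Bochner integral with the nonnegative one instead of the
  default 0; positivity holds because the integrand is positive on a nonempty open set.\<close>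

lemma kappa_pos:
  assumes "\<mu> > rho_of TYPE('n::finite) - 1"
  shows "0 < kappa \<mu> TYPE('n)"
proof -
  define al where "al = \<mu> - rho_of TYPE('n)"
  have al: "-1 < al" using assms by (simp add: al_def)
  define h where "h v = indicator ballD v *\<^sub>R det (mat 1 - transpose v ** v) powr al" for v :: "real^'n^'n"
  have h: "ennreal (h v) = pd_power al (mat 1 - transpose v ** v)" for v
    by (auto simp: h_def pd_power_def ballD_def indicator_def)
  have k: "kappa \<mu> TYPE('n) = (\<integral>v. h v \<partial>lborel)"
    by (simp add: kappa_def set_lebesgue_integral_def h_def al_def)
  have cont: "(\<lambda>v::real^'n^'n. mat 1 - transpose v ** v) \<in> borel_measurable borel"
    by (intro borel_measurable_continuous_onI continuous_intros)
  have hm [measurable]: "h \<in> borel_measurable borel"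
  proof -
    note [measurable] = measurable_compose[OF cont measurable_det]
    show ?thesis
      unfolding h_def
      by (intro borel_measurable_scaleR borel_measurable_indicator ballD_sets) measurable
  qed
  have h_nonneg: "0 \<le> h v" for v by (simp add: h_def)
  have "(\<integral>v. h v \<partial>lborel) = enn2real (\<integral>\<^sup>+ v. ennreal (h v) \<partial>lborel)"
    by (rule integral_eq_nn_integral) (simp_all add: h_nonneg)
  moreover have "(\<integral>\<^sup>+ v. ennreal (h v) \<partial>lborel) < top"
    using ballD_weight_finite[OF al, where 'n='n] by (simp add: h)
  moreover have "(\<integral>\<^sup>+ v. ennreal (h v) \<partial>lborel) \<noteq> 0"
  proof
    assume "(\<integral>\<^sup>+ v. ennreal (h v) \<partial>lborel) = 0"
    then have "AE v in lborel. ennreal (h v) = 0" by (subst (asm) nn_integral_0_iff_AE) auto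
    then have "AE v in lborel. v \<notin> (ballD :: (real^'n^'n) set)"
    proof (rule AE_mp, intro AE_I2 impI)
      fix v :: "real^'n^'n" assume "ennreal (h v) = 0"
      then show "v \<notin> ballD"
        using pd_mat_msqrt(4)[of "mat 1 - transpose v ** v"]
        by (auto simp: h pd_power_def ballD_def split: if_splits)
    qed
    then have "emeasure lborel (ballD :: (real^'n^'n) set) = 0"
      by (subst (asm) AE_iff_measurable[of "ballD"]) auto
    moreover have "(0 :: real^'n^'n) \<in> ballD" by (simp add: ballD_iff)
    ultimately show False using emeasure_lborel_open_nonempty[OF open_ballD] by blast
  qed
  ultimately show ?thesis unfolding k by (simp add: enn2real_positive_iff zero_less_iff_neq_zero)
qed

lemma sets_base_measure: "sets (base_measure \<mu>) = sets (restrict_space borel ballD)"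
  by (simp add: base_measure_def cong: sets_restrict_space_cong)

lemma space_base_measure: "space (base_measure \<mu>) = ballD"
  by (simp add: base_measure_def space_restrict_space)

definition base_weight :: "real \<Rightarrow> real^'n^'n \<Rightarrow> ennreal" where
  "base_weight \<mu> v = ennreal (det (mat 1 - v ** transpose v) powr (\<mu> - rho_of TYPE('n)) / kappa \<mu> TYPE('n))"

lemma measurable_base_weight [measurable]: "(base_weight \<mu> :: real^'n^'n \<Rightarrow> _) \<in> borel_measurable borel"
proof -
  have cont: "(\<lambda>v::real^'n^'n. mat 1 - v ** transpose v) \<in> borel_measurable borel"
    by (intro borel_measurable_continuous_onI continuous_intros)
  note [measurable] = measurable_compose[OF cont measurable_det]
  show ?thesis unfolding base_weight_def by measurable
qed

lemma emeasure_base_measure: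
  fixes A :: "(real^'n^'n) set"
  assumes "A \<in> sets borel" "A \<subseteq> ballD"
  shows "emeasure (base_measure \<mu>) A = (\<integral>\<^sup>+ v. base_weight \<mu> v * indicator A v \<partial>lborel)"
proof -
  have bm: "base_measure \<mu> = density (restrict_space lborel ballD) (base_weight \<mu>)"
    by (simp add: base_measure_def base_weight_def[abs_def])
  have A: "A \<in> sets (restrict_space lborel ballD)"
    using assms by (simp add: sets_restrict_space_iff)
  have "emeasure (base_measure \<mu>) A
      = (\<integral>\<^sup>+ v. base_weight \<mu> v * indicator A v \<partial>restrict_space lborel ballD)"
    unfolding bm by (rule emeasure_density[OF _ A]) (rule measurable_restrict_space1, simp)
  also have "\<dots> = (\<integral>\<^sup>+ v. base_weight \<mu> v * indicator A v * indicator ballD v \<partial>lborel)"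
    by (rule nn_integral_restrict_space) simp
  also have "\<dots> = (\<integral>\<^sup>+ v. base_weight \<mu> v * indicator A v \<partial>lborel)"
    using assms(2) by (intro nn_integral_cong) (auto simp: indicator_def)
  finally show ?thesis .
qed

lemma emeasure_base_measure_open:
  fixes W :: "(real^'n^'n) set"
  assumes \<mu>: "\<mu> > rho_of TYPE('n) - 1" and "open W" and ne: "W \<inter> ballD \<noteq> {}"
  shows "emeasure (base_measure \<mu>) (W \<inter> ballD) \<noteq> 0"
proof
  have m [measurable]: "W \<inter> ballD \<in> sets borel" using \<open>open W\<close> by auto
  assume "emeasure (base_measure \<mu>) (W \<inter> ballD) = 0"
  then have "(\<integral>\<^sup>+ v. base_weight \<mu> v * indicator (W \<inter> ballD) v \<partial>lborel) = 0"
    by (subst (asm) emeasure_base_measure) auto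
  then have "AE v in lborel. base_weight \<mu> v * indicator (W \<inter> ballD) v = 0"
    by (subst (asm) nn_integral_0_iff_AE) auto
  then have "AE v in lborel. v \<notin> W \<inter> ballD"
  proof (rule AE_mp, intro AE_I2 impI)
    fix v :: "real^'n^'n" assume v: "base_weight \<mu> v * indicator (W \<inter> ballD) v = 0"
    have "base_weight \<mu> v \<noteq> 0" if "v \<in> ballD"
      using kappa_pos[OF \<mu>] det_one_minus_mult_transpose_nz[OF that]
      by (simp add: base_weight_def divide_le_0_iff not_le)
    then show "v \<notin> W \<inter> ballD" using v by (auto simp: indicator_def split: if_splits)
  qed
  then have "emeasure lborel (W \<inter> ballD) = 0"
    by (subst (asm) AE_iff_measurable[of "W \<inter> ballD"]) auto
  then show False
    using emeasure_lborel_open_nonempty[OF open_Int[OF \<open>open W\<close> open_ballD] ne] by simp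
qed

section \<open>Supports of convolutions and their images under homeomorphisms\<close>

definition bmap :: "real^'n^'n \<Rightarrow> real^'n^'n \<Rightarrow> real^'n^'n \<Rightarrow> real^'n^'n" where
  "bmap r s v = msqrt (mixture r s v)"

lemma bconv_eq: "bconv \<mu> r s = distr (base_measure \<mu>) (restrict_space borel psd) (bmap r s)"
  by (simp add: bconv_def bmap_def[abs_def] mixture_def[abs_def])

lemma bmap_psd: "r \<in> psd \<Longrightarrow> s \<in> psd \<Longrightarrow> v \<in> contractions \<Longrightarrow> bmap r s v \<in> psd"
  by (simp add: bmap_def msqrt_psd mixture_psd psd_symmetric)

lemma continuous_on_bmap:
  assumes "r \<in> psd" "s \<in> psd" shows "continuous_on contractions (bmap r s)"
  unfolding bmap_def
proof (rule continuous_on_compose2[OF continuous_on_msqrt])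
  show "continuous_on contractions (mixture r s)"
    unfolding mixture_def by (intro continuous_intros)
qed (use assms in \<open>auto intro: mixture_psd simp: psd_symmetric\<close>)

lemma measurable_bmap:
  assumes "r \<in> psd" "s \<in> psd"
  shows "bmap r s \<in> base_measure \<mu> \<rightarrow>\<^sub>M restrict_space borel psd"
proof (rule measurable_restrict_space2)
  show "bmap r s \<in> space (base_measure \<mu>) \<rightarrow> psd"
    using bmap_psd[OF assms] ballD_subset_contractions by (auto simp: space_base_measure)
  have "bmap r s \<in> borel_measurable (restrict_space borel ballD)"
    by (intro borel_measurable_continuous_on_restrict
        continuous_on_subset[OF continuous_on_bmap[OF assms] ballD_subset_contractions])
  then show "bmap r s \<in> borel_measurable (base_measure \<mu>)"
    by (simp cong: measurable_cong_sets add: sets_base_measure)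
qed

text \<open>The topological support relative to the cone: the measures live on the restricted Borel
  sets, so open sets are intersected with \<open>psd\<close>.\<close>

definition psd_support :: "(real^'n^'n) measure \<Rightarrow> (real^'n^'n) set" where
  "psd_support M = {p \<in> psd. \<forall>U. open U \<longrightarrow> p \<in> U \<longrightarrow> emeasure M (U \<inter> psd) \<noteq> 0}"

text \<open>The image of the compact set of contractions is closed, so nothing outside it is in the
  support. Conversely, a neighbourhood of an image point pulls back to a relatively open set, which
  meets the dense open ball in a set of positive measure.\<close>

lemma psd_support_bconv:
  fixes r s :: "real^'n^'n"
  assumes \<mu>: "\<mu> > rho_of TYPE('n) - 1" and rs: "r \<in> psd" "s \<in> psd"
  shows "psd_support (bconv \<mu> r s) = bmap r s ` contractions"
proof -
  have em: "emeasure (bconv \<mu> r s) (U \<inter> psd) = emeasure (base_measure \<mu>) (bmap r s -` U \<inter> ballD)" if "open U" for U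
  proof -
    have "bmap r s -` (U \<inter> psd) \<inter> ballD = bmap r s -` U \<inter> ballD"
      using bmap_psd[OF rs] ballD_subset_contractions by auto
    then show ?thesis
      unfolding bconv_eq using that
      by (subst emeasure_distr[OF measurable_bmap[OF rs]])
        (auto simp: space_base_measure sets_restrict_space)
  qed
  show ?thesis
  proof (intro equalityI subsetI)
    fix p assume p: "p \<in> psd_support (bconv \<mu> r s)"
    show "p \<in> bmap r s ` contractions"
    proof (rule ccontr)
      assume np: "p \<notin> bmap r s ` contractions"
      have "compact (bmap r s ` contractions)"
        by (intro compact_continuous_image continuous_on_bmap rs compact_contractions)
      then have op: "open (- (bmap r s ` contractions))" by (simp add: compact_imp_closed open_Compl)
      have "bmap r s -` (- (bmap r s ` contractions)) \<inter> ballD = {}"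
        using ballD_subset_contractions by auto
      then have "emeasure (bconv \<mu> r s) (- (bmap r s ` contractions) \<inter> psd) = 0"
        using em[OF op] by simp
      then show False using p op np unfolding psd_support_def by blast
    qed
  next
    fix p assume "p \<in> bmap r s ` contractions"
    then obtain v where v: "v \<in> contractions" and p: "p = bmap r s v" by blast
    have "emeasure (bconv \<mu> r s) (U \<inter> psd) \<noteq> 0" if U: "open U" "p \<in> U" for U
    proof -
      obtain W where W: "open W" "W \<inter> contractions = bmap r s -` U \<inter> contractions"
        using continuous_on_bmap[OF rs] U(1) unfolding continuous_on_open_invariant by blast
      have "v \<in> W" using W(2) v U(2) p by blast
      then have "W \<inter> ballD \<noteq> {}"
        using contractions_subset_closure_ballD v open_Int_closure_eq_empty[OF W(1), of ballD] by blast
      moreover have "bmap r s -` U \<inter> ballD = W \<inter> ballD"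
        using W(2) ballD_subset_contractions by blast
      ultimately show ?thesis
        using emeasure_base_measure_open[OF \<mu> W(1)] by (simp add: em[OF U(1)])
    qed
    then show "p \<in> psd_support (bconv \<mu> r s)"
      unfolding psd_support_def using bmap_psd[OF rs v] p by blast
  qed
qed

lemma measurable_psd_continuous:
  assumes "continuous_on psd T" "T ` psd \<subseteq> psd" "sets M = sets (restrict_space borel psd)"
  shows "T \<in> M \<rightarrow>\<^sub>M restrict_space borel psd"
proof -
  have "T \<in> restrict_space borel psd \<rightarrow>\<^sub>M restrict_space borel psd"
    using assms(1,2)
    by (intro measurable_restrict_space2 borel_measurable_continuous_on_restrict)
      (auto simp: space_restrict_space)
  then show ?thesis using measurable_cong_sets[OF assms(3) refl] by blast
qed

lemma psd_support_distr:
  fixes T :: "real^'n^'n \<Rightarrow> real^'n^'n"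
  assumes hom: "homeomorphism psd psd T T'" and M: "sets M = sets (restrict_space borel psd)"
  shows "psd_support (distr M (restrict_space borel psd) T) = T ` psd_support M"
proof -
  let ?N = "distr M (restrict_space borel psd) T"
  have cont: "continuous_on psd T" "continuous_on psd T'"
    and img: "T ` psd = psd" "T' ` psd = psd"
    and inv: "\<And>x. x \<in> psd \<Longrightarrow> T' (T x) = x"
    using hom by (auto simp: homeomorphism_def)
  have sp: "space M = psd" using sets_eq_imp_space_eq[OF M] by (simp add: space_restrict_space)
  have em: "emeasure ?N (U \<inter> psd) = emeasure M (T -` U \<inter> psd)" if "open U" for U
  proof -
    have "T -` (U \<inter> psd) \<inter> psd = T -` U \<inter> psd" using img by blast
    then show ?thesis
      using that measurable_psd_continuous[OF cont(1) _ M] img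
      by (subst emeasure_distr) (auto simp: sp sets_restrict_space)
  qed
  have iff: "T p \<in> psd_support ?N \<longleftrightarrow> p \<in> psd_support M" if p: "p \<in> psd" for p
  proof
    assume sup: "T p \<in> psd_support ?N"
    have "emeasure M (V \<inter> psd) \<noteq> 0" if V: "open V" "p \<in> V" for V
    proof -
      obtain U where U: "open U" "U \<inter> psd = T' -` V \<inter> psd"
        using cont(2) V(1) unfolding continuous_on_open_invariant by blast
      have "T p \<in> U" using U(2) V(2) inv[OF p] img p by blast
      moreover have "T -` U \<inter> psd = V \<inter> psd"
      proof -
        have "q \<in> T -` U \<longleftrightarrow> q \<in> V" if "q \<in> psd" for q
        proof -
          have "T q \<in> psd" using img that by blast
          then have "T q \<in> U \<longleftrightarrow> T' (T q) \<in> V" using U(2) by blast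
          then show ?thesis by (simp add: inv[OF that])
        qed
        then show ?thesis by blast
      qed
      ultimately show ?thesis using sup em[OF U(1)] U(1) unfolding psd_support_def by force
    qed
    then show "p \<in> psd_support M" using p by (simp add: psd_support_def)
  next
    assume sup: "p \<in> psd_support M"
    have "emeasure ?N (U \<inter> psd) \<noteq> 0" if U: "open U" "T p \<in> U" for U
    proof -
      obtain V where V: "open V" "V \<inter> psd = T -` U \<inter> psd"
        using cont(1) U(1) unfolding continuous_on_open_invariant by blast
      have "p \<in> V" using V(2) U(2) p by blast
      then show ?thesis using sup V em[OF U(1)] unfolding psd_support_def by force
    qed
    then show "T p \<in> psd_support ?N" using img p by (auto simp: psd_support_def)
  qed
  have "psd_support ?N \<subseteq> psd" "psd_support M \<subseteq> psd" by (auto simp: psd_support_def)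
  then show ?thesis
  proof (intro equalityI subsetI)
    fix q assume q: "q \<in> psd_support ?N"
    then obtain p where "p \<in> psd" "q = T p" using \<open>psd_support ?N \<subseteq> psd\<close> img by (metis imageE subsetD)
    then show "q \<in> T ` psd_support M" using q iff by blast
  next
    fix q assume "q \<in> T ` psd_support M"
    then obtain p where p: "p \<in> psd_support M" "q = T p" by blast
    then have "p \<in> psd" by (simp add: psd_support_def)
    then show "q \<in> psd_support ?N" using p iff by simp
  qed
qed

lemma sets_bconv: "sets (bconv \<mu> r s) = sets (restrict_space borel psd)"
  by (simp add: bconv_eq)

lemma hyp_aut_imp_congruence:
  fixes T :: "real^'n^'n \<Rightarrow> real^'n^'n"
  assumes \<mu>: "\<mu> > rho_of TYPE('n) - 1" and aut: "hyp_aut \<mu> T"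
  shows "\<exists>a. invertible a \<and> (\<forall>r\<in>psd. T r = T_a a r)"
proof -
  obtain T' where hom: "homeomorphism psd psd T T'"
    using aut unfolding hyp_aut_def by blast
  have cont: "continuous_on psd T" and img: "T ` psd = psd"
    and inv: "\<And>x. x \<in> psd \<Longrightarrow> T' (T x) = x"
    using hom by (auto simp: homeomorphism_def)
  have Tpsd: "T x \<in> psd" if "x \<in> psd" for x using img that by blast
  have Tsup: "T ` bmap r s ` contractions = bmap (T r) (T s) ` contractions" if rs: "r \<in> psd" "s \<in> psd" for r s
  proof -
    have "distr (bconv \<mu> r s) (restrict_space borel psd) T = bconv \<mu> (T r) (T s)"
      using aut rs unfolding hyp_aut_def by blast
    then show ?thesis
      using psd_support_distr[OF hom sets_bconv[of \<mu> r s]]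
      by (simp add: psd_support_bconv[OF \<mu>] rs Tpsd)
  qed
  \<comment> \<open>T in squared coordinates; \<open>sqrtF\<close> recovers T from it.\<close>
  define F where "F R = T (msqrt R) ** T (msqrt R)" for R :: "real^'n^'n"
  have sqrtF: "msqrt (F R) = T (msqrt R)" if "R \<in> psd" for R
    unfolding F_def using that by (intro msqrt_of_square Tpsd msqrt_psd)
  have "bij_betw F psd psd"
  proof (rule bij_betw_imageI)
    show "inj_on F psd"
    proof (rule inj_onI)
      fix R S assume RS: "R \<in> psd" "S \<in> psd" "F R = F S"
      then have "T (msqrt R) = T (msqrt S)" using sqrtF by metis
      then have "msqrt R = msqrt S" using RS inv msqrt_psd by metis
      then show "R = S" using RS msqrt_square by metis
    qed
    show "F ` psd = psd"
    proof (intro equalityI subsetI)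
      fix X :: "real^'n^'n" assume X: "X \<in> psd"
      then obtain y where y: "y \<in> psd" "T y = msqrt X" using img msqrt_psd by (metis imageE)
      then have "F (y ** y) = X" using X by (simp add: F_def msqrt_of_square msqrt_square)
      then show "X \<in> F ` psd" using psd_square[OF y(1)] by blast
    qed (auto simp: F_def intro!: psd_square Tpsd msqrt_psd)
  qed
  moreover have "continuous_on psd F"
    unfolding F_def
    by (intro continuous_intros continuous_on_compose2[OF cont continuous_on_msqrt]) (auto intro: msqrt_psd)
  moreover have "F ` mixtures R S = mixtures (F R) (F S)" if RS: "R \<in> psd" "S \<in> psd" for R S
  proof -
    let ?r = "msqrt R" and ?s = "msqrt S"
    have psd: "?r \<in> psd" "?s \<in> psd" "T ?r \<in> psd" "T ?s \<in> psd" using RS by (auto intro: msqrt_psd Tpsd)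
    \<comment> \<open>Squaring cancels the root in \<open>bmap\<close>, so the identity of supports
      becomes one of sets of mixtures.\<close>
    have "F ` mixtures R S = (\<lambda>X. X ** X) ` T ` bmap ?r ?s ` contractions"
      by (simp add: mixtures_def F_def bmap_def image_image)
    also have "\<dots> = (\<lambda>X. X ** X) ` bmap (T ?r) (T ?s) ` contractions"
      by (simp only: Tsup[OF psd(1,2)])
    also have "\<dots> = mixture (T ?r) (T ?s) ` contractions"
      unfolding image_image bmap_def using psd
      by (intro image_cong refl msqrt_square mixture_psd) (auto simp: psd_symmetric)
    also have "\<dots> = mixtures (F R) (F S)" using RS by (simp add: mixtures_def sqrtF)
    finally show ?thesis .
  qed
  ultimately obtain a where a: "invertible a" "\<And>R. R \<in> psd \<Longrightarrow> F R = a ** R ** transpose a"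
    using mixtures_preserving_imp_congruence[of F] by blast
  have "T r = T_a a r" if r: "r \<in> psd" for r
  proof -
    have "msqrt (F (r ** r)) = T r" using sqrtF[OF psd_square[OF r]] msqrt_of_square[OF r] by simp
    then show ?thesis using a(2)[OF psd_square[OF r]] by (simp add: T_a_def matrix_mul_assoc)
  qed
  then show ?thesis using a(1) by blast
qed

section \<open>Congruences are automorphisms\<close>

lemma nn_integral_transpose:
  fixes f :: "real^'n^'n \<Rightarrow> ennreal"
  assumes [measurable]: "f \<in> borel_measurable borel"
  shows "(\<integral>\<^sup>+ v. f (transpose v) \<partial>lborel) = (\<integral>\<^sup>+ v. f v \<partial>lborel)"
proof -
  have h [measurable]: "(transpose :: real^'n^'n \<Rightarrow> _) \<in> borel_measurable borel"
    by (intro borel_measurable_continuous_onI continuous_intros)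
  have prodB: "(\<Prod>b\<in>(Basis :: (real^'n^'n) set). w \<bullet> b) = (\<Prod>i\<in>UNIV. \<Prod>j\<in>UNIV. w $ i $ j)" for w :: "real^'n^'n"
    by (simp add: prod_Basis_vec inner_axis)
  have boxm: "v \<in> box l u \<longleftrightarrow> (\<forall>i j. l $ i $ j < v $ i $ j \<and> v $ i $ j < u $ i $ j)" for v l u :: "real^'n^'n"
    by (auto simp: mem_box Basis_vec_def inner_axis)
  have "(lborel :: (real^'n^'n) measure) = distr lborel borel transpose"
  proof (rule lborel_eqI)
    fix l u :: "real^'n^'n" assume le: "\<And>b. b \<in> Basis \<Longrightarrow> l \<bullet> b \<le> u \<bullet> b"
    have le': "l $ i $ j \<le> u $ i $ j" for i j
      using le[of "axis i (axis j 1)"] by (auto simp: inner_axis Basis_vec_def)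
    have "transpose -` box l u = box (transpose l) (transpose u)"
      by (auto simp: boxm transpose_def)
    then have "emeasure (distr lborel borel transpose) (box l u) = emeasure lborel (box (transpose l) (transpose u))"
      by (simp add: emeasure_distr)
    also have "\<dots> = ennreal (\<Prod>b\<in>Basis. (transpose u - transpose l) \<bullet> b)"
      using le' by (intro emeasure_lborel_box) (auto simp: inner_axis Basis_vec_def transpose_def)
    also have "(\<Prod>b\<in>Basis. (transpose u - transpose l) \<bullet> b) = (\<Prod>b\<in>Basis. (u - l) \<bullet> b)"
      unfolding prodB by (subst prod.swap) (simp add: transpose_def)
    finally show "emeasure (distr lborel borel transpose) (box l u) = ennreal (\<Prod>b\<in>Basis. (u - l) \<bullet> b)" .
  qed simp
  then have "(\<integral>\<^sup>+ v. f v \<partial>lborel) = (\<integral>\<^sup>+ v. f v \<partial>distr lborel borel transpose)" by simp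
  also have "\<dots> = (\<integral>\<^sup>+ v. f (transpose v) \<partial>lborel)" by (rule nn_integral_distr) simp_all
  finally show ?thesis ..
qed

lemma nn_integral_orthogonal_left:
  fixes W :: "real^'n^'n"
  assumes "f \<in> borel_measurable borel" "orthogonal_matrix W"
  shows "(\<integral>\<^sup>+ v. f (W ** v) \<partial>(lborel :: (real^'n^'n) measure)) = (\<integral>\<^sup>+ v. f v \<partial>lborel)"
proof -
  have "\<bar>det W\<bar> = 1" "det W \<noteq> 0" using det_orthogonal_matrix[OF assms(2)] by auto
  then show ?thesis
    using nn_integral_vec_action[OF assms(1), of W] by (simp add: vec_action_matrix_mult)
qed

text \<open>Right multiplication is left multiplication conjugated by transposition, which permutes
  the matrix entries and so preserves Lebesgue measure.\<close>

lemma nn_integral_orthogonal: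
  fixes U W :: "real^'n^'n"
  assumes f: "f \<in> borel_measurable borel" and W: "orthogonal_matrix W" and U: "orthogonal_matrix U"
  shows "(\<integral>\<^sup>+ v. f (W ** v ** transpose U) \<partial>(lborel :: (real^'n^'n) measure)) = (\<integral>\<^sup>+ v. f v \<partial>lborel)"
proof -
  have m: "(\<lambda>v::real^'n^'n. f (g v)) \<in> borel_measurable borel" if "continuous_on UNIV g" for g
    by (rule measurable_compose[OF borel_measurable_continuous_onI[OF that] f])
  have "(\<integral>\<^sup>+ v. f (W ** v ** transpose U) \<partial>(lborel :: (real^'n^'n) measure))
      = (\<integral>\<^sup>+ v. f (v ** transpose U) \<partial>lborel)"
    by (rule nn_integral_orthogonal_left[where f = "\<lambda>v. f (v ** transpose U)", OF m W]) (intro continuous_intros)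
  also have "\<dots> = (\<integral>\<^sup>+ v. f (transpose v ** transpose U) \<partial>lborel)"
    by (rule nn_integral_transpose[OF m, symmetric]) (intro continuous_intros)
  also have "\<dots> = (\<integral>\<^sup>+ v. f (transpose (U ** v)) \<partial>lborel)"
    by (simp add: matrix_transpose_mul)
  also have "\<dots> = (\<integral>\<^sup>+ v. f (transpose v) \<partial>lborel)"
    by (rule nn_integral_orthogonal_left[where f = "\<lambda>v. f (transpose v)", OF m U]) (intro continuous_intros)
  also have "\<dots> = (\<integral>\<^sup>+ v. f v \<partial>lborel)" by (rule nn_integral_transpose[OF f])
  finally show ?thesis .
qed

lemma orthogonal_matrix_norm:
  fixes U :: "real^'n^'n"
  assumes "orthogonal_matrix U"
  shows "norm (U *v x) = norm x" "norm (transpose U *v x) = norm x"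
proof -
  have "(norm (V *v x))\<^sup>2 = (norm x)\<^sup>2" if "transpose V ** V = mat 1" for V :: "real^'n^'n"
    using that by (simp add: power2_norm_eq_inner inner_matrix_vector_left matrix_vector_mul_assoc)
  then show "norm (U *v x) = norm x" "norm (transpose U *v x) = norm x"
    using assms unfolding orthogonal_matrix_def by auto
qed

lemma ballD_orthogonal:
  fixes U W :: "real^'n^'n"
  assumes U: "orthogonal_matrix U" and W: "orthogonal_matrix W" and v: "v \<in> ballD"
  shows "W ** v ** transpose U \<in> ballD"
  unfolding ballD_iff
proof (intro allI impI)
  fix x :: "real^'n" assume "x \<noteq> 0"
  then have "transpose U *v x \<noteq> 0" using orthogonal_matrix_norm(2)[OF U, of x] by auto
  then have "norm (v *v (transpose U *v x)) < norm (transpose U *v x)" using v by (simp add: ballD_iff)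
  then show "norm ((W ** v ** transpose U) *v x) < norm x"
    by (simp add: matrix_vector_mul_assoc[symmetric] orthogonal_matrix_norm U W)
qed

lemma orthogonal_conjugate_back:
  fixes U W :: "real^'n^'n"
  assumes "orthogonal_matrix U" "orthogonal_matrix W"
  shows "transpose W ** (W ** v ** transpose U) ** transpose (transpose U) = v"
proof -
  have "transpose W ** (W ** v ** transpose U) ** transpose (transpose U)
      = (transpose W ** W) ** v ** (transpose U ** U)"
    by (simp only: matrix_mul_assoc transpose_transpose)
  then show ?thesis using assms by (simp add: orthogonal_matrix_def)
qed

lemma base_weight_orthogonal:
  fixes U W :: "real^'n^'n"
  assumes U: "orthogonal_matrix U" and W: "orthogonal_matrix W"
  shows "base_weight \<mu> (W ** v ** transpose U) = base_weight \<mu> v"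
proof -
  have eq: "mat 1 - (W ** v ** transpose U) ** transpose (W ** v ** transpose U)
      = W ** (mat 1 - v ** transpose v) ** transpose W"
  proof -
    have "(W ** v ** transpose U) ** transpose (W ** v ** transpose U)
        = W ** v ** (transpose U ** U) ** transpose v ** transpose W"
      by (simp only: matrix_transpose_mul transpose_transpose matrix_mul_assoc)
    also have "\<dots> = W ** (v ** transpose v) ** transpose W"
      using U by (simp only: orthogonal_matrix_def matrix_mul_rid matrix_mul_assoc)
    finally show ?thesis
      using W by (simp only: orthogonal_matrix_def matrix_sub_ldistrib matrix_sub_rdistrib matrix_mul_rid)
  qed
  \<comment> \<open>The determinant of W is 1 or -1 and occurs twice.\<close>
  have d: "det W * d * det W = d" for d using det_orthogonal_matrix[OF W] by auto
  show ?thesis unfolding base_weight_def eq det_mul det_transpose d ..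
qed

lemma base_measure_orthogonal:
  fixes U W :: "real^'n^'n"
  assumes U: "orthogonal_matrix U" and W: "orthogonal_matrix W"
  defines "g \<equiv> \<lambda>v. W ** v ** transpose U"
  shows "g \<in> base_measure \<mu> \<rightarrow>\<^sub>M base_measure \<mu>" "distr (base_measure \<mu>) (base_measure \<mu>) g = base_measure \<mu>"
proof -
  have gm: "g \<in> borel_measurable borel"
    unfolding g_def by (intro borel_measurable_continuous_onI continuous_intros)
  have gD: "g v \<in> ballD \<longleftrightarrow> v \<in> ballD" for v
    using ballD_orthogonal[OF U W, of v]
      ballD_orthogonal[of "transpose U" "transpose W" "g v"] orthogonal_conjugate_back[OF U W, of v] U W
    by (auto simp: g_def)
  have "g \<in> restrict_space borel ballD \<rightarrow>\<^sub>M restrict_space borel ballD"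
    using gm gD by (intro measurable_restrict_space2 measurable_restrict_space1) (auto simp: space_restrict_space)
  then show gmb: "g \<in> base_measure \<mu> \<rightarrow>\<^sub>M base_measure \<mu>"
    using measurable_cong_sets[OF sets_base_measure sets_base_measure] by blast
  show "distr (base_measure \<mu>) (base_measure \<mu>) g = base_measure \<mu>"
  proof (rule measure_eqI)
    fix A assume "A \<in> sets (distr (base_measure \<mu>) (base_measure \<mu>) g)"
    then have A0: "A \<in> sets (base_measure \<mu>)" by simp
    then have A: "A \<in> sets borel" "A \<subseteq> ballD"
      by (auto simp: sets_base_measure sets_restrict_space)
    have gA: "g -` A \<inter> ballD = g -` A" using A(2) gD by auto
    have gAs: "g -` A \<in> sets borel" using measurable_sets[OF gm A(1)] by simp
    have "emeasure (distr (base_measure \<mu>) (base_measure \<mu>) g) A = emeasure (base_measure \<mu>) (g -` A)"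
      by (simp add: emeasure_distr[OF gmb A0] space_base_measure gA)
    also have "\<dots> = (\<integral>\<^sup>+ v. base_weight \<mu> v * indicator (g -` A) v \<partial>lborel)"
      using gAs gA by (intro emeasure_base_measure) auto
    also have "\<dots> = (\<integral>\<^sup>+ v. base_weight \<mu> (g v) * indicator A (g v) \<partial>lborel)"
      by (intro nn_integral_cong) (auto simp: g_def base_weight_orthogonal[OF U W] indicator_def)
    also have "\<dots> = (\<integral>\<^sup>+ v. base_weight \<mu> v * indicator A v \<partial>lborel)"
      unfolding g_def
      by (rule nn_integral_orthogonal[OF _ W U, where f = "\<lambda>v. base_weight \<mu> v * indicator A v"])
        (use A(1) in measurable)
    also have "\<dots> = emeasure (base_measure \<mu>) A"
      using A by (intro emeasure_base_measure[symmetric])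
    finally show "emeasure (distr (base_measure \<mu>) (base_measure \<mu>) g) A = emeasure (base_measure \<mu>) A" .
  qed simp
qed

text \<open>For invertible x the factor is forced: U = X^-1 a x with X = \<open>T_a a x\<close>, and
  U U^T = I because X^2 = a x^2 a^T. A singular x is approximated by x + I/(k+1), and the orthogonal
  factors converge along a subsequence.\<close>

lemma psd_polar:
  fixes a x :: "real^'n^'n"
  assumes x: "x \<in> psd" and a: "invertible a"
  obtains U where "orthogonal_matrix U" "a ** x = T_a a x ** U"
proof -
  define x' where "x' k = x + inverse (real (Suc k)) *\<^sub>R mat 1" for k
  note reg = msqrt_regularized[OF x, folded x'_def]
  define X where "X k = T_a a (x' k)" for k
  have cong: "a ** y ** y ** transpose a \<in> psd" if "y \<in> psd" for y
    using psd_congruence[OF psd_square[OF that], of a] by (simp add: matrix_mul_assoc)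
  have Xsq: "X k ** X k = a ** x' k ** x' k ** transpose a" for k
    unfolding X_def T_a_def by (intro msqrt_square cong reg)
  have Xsym: "transpose (X k) = X k" for k
    unfolding X_def T_a_def by (intro psd_symmetric msqrt_psd cong reg)
  have x'sym: "transpose (x' k) = x' k" for k by (intro psd_symmetric reg)
  have ainj: "y = 0" if "a *v y = 0" for y
    using a that by (metis invertible_left_inverse matrix_left_invertible_ker)
  have tainj: "y = 0" if "transpose a *v y = 0" for y
    using a that transpose_invertible by (metis invertible_left_inverse matrix_left_invertible_ker)
  have "invertible (x' k)" for k
    using invertible_mult[OF reg(2) reg(2), of k k] by (simp add: msqrt_square reg(1))
  then have x'inj: "y = 0" if "x' k *v y = 0" for y k
    using that by (metis invertible_left_inverse matrix_left_invertible_ker)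
  have Xinv: "invertible (X k)" for k
  proof (rule invertible_if_kernel_trivial)
    fix y assume "X k *v y = 0"
    then have "(X k ** X k) *v y = 0" by (metis matrix_vector_mul_assoc matrix_vector_mult_0_right)
    then have "a *v (x' k *v (x' k *v (transpose a *v y))) = 0"
      by (simp add: Xsq matrix_vector_mul_assoc matrix_mul_assoc)
    then show "y = 0" using ainj x'inj tainj by blast
  qed
  define U where "U k = matrix_inv (X k) ** a ** x' k" for k
  \<comment> \<open>The orthogonal group, written as a closed subset of the compact set of
    contractions.\<close>
  let ?O = "contractions \<inter> {U. U ** transpose U = (mat 1 :: real^'n^'n)}"
  have XU: "a ** x' k = X k ** U k" for k
  proof -
    have "X k ** U k = (X k ** matrix_inv (X k)) ** a ** x' k" by (simp only: U_def matrix_mul_assoc)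
    then show ?thesis by (simp add: invertible_matrix_inv[OF Xinv])
  qed
  have UO: "U k \<in> ?O" for k
  proof -
    let ?i = "matrix_inv (X k)"
    have i: "X k ** ?i = mat 1" "?i ** X k = mat 1" using invertible_matrix_inv[OF Xinv] by auto
    have "X k ** transpose ?i = mat 1"
      using arg_cong[OF i(2), of transpose] by (simp add: matrix_transpose_mul Xsym)
    then have isym: "transpose ?i = ?i" by (metis i(2) matrix_mul_assoc matrix_mul_lid matrix_mul_rid)
    have "U k ** transpose (U k) = ?i ** (a ** x' k ** x' k ** transpose a) ** ?i"
      by (simp only: U_def matrix_transpose_mul isym x'sym matrix_mul_assoc)
    also have "\<dots> = (?i ** X k) ** (X k ** ?i)" by (simp only: Xsq[symmetric] matrix_mul_assoc)
    finally have o: "U k ** transpose (U k) = mat 1" by (simp add: i)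
    then have "orthogonal_matrix (U k)" by (simp add: orthogonal_matrix_def matrix_left_right_inverse)
    then show ?thesis using o by (simp add: contractions_def orthogonal_matrix_norm)
  qed
  have "compact ?O"
    by (intro compact_Int_closed compact_contractions closed_Collect_eq continuous_intros)
  then obtain l h where l: "l \<in> ?O" and h: "strict_mono h" "(U \<circ> h) \<longlonglongrightarrow> l"
    using UO unfolding compact_def by blast
  have lim: "(\<lambda>k. a ** x' k ** x' k ** transpose a) \<longlonglongrightarrow> a ** x ** x ** transpose a"
    by (intro tendsto_intros reg)
  have XX: "X \<longlonglongrightarrow> T_a a x"
    using continuous_on_tendsto_compose[OF continuous_on_msqrt lim cong[OF x]] cong[OF reg(1)]
    unfolding X_def T_a_def by simp
  have "(\<lambda>k. X (h k) ** (U \<circ> h) k) \<longlonglongrightarrow> T_a a x ** l"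
    using LIMSEQ_subseq_LIMSEQ[OF XX h(1)] h(2) by (intro tendsto_intros) (simp_all add: o_def)
  then have "(\<lambda>k. a ** x' (h k)) \<longlonglongrightarrow> T_a a x ** l" by (simp add: XU)
  moreover have "(\<lambda>k. a ** x' (h k)) \<longlonglongrightarrow> a ** x"
    using LIMSEQ_subseq_LIMSEQ[OF reg(4) h(1)] by (intro tendsto_intros) (simp add: o_def)
  ultimately have "a ** x = T_a a x ** l" using LIMSEQ_unique by blast
  moreover have "orthogonal_matrix l"
    using l by (simp add: orthogonal_matrix_def matrix_left_right_inverse)
  ultimately show thesis using that by blast
qed

lemma T_a_psd: "r \<in> psd \<Longrightarrow> T_a a r \<in> psd"
  and T_a_square: "r \<in> psd \<Longrightarrow> T_a a r ** T_a a r = a ** r ** r ** transpose a"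
  using psd_congruence[OF psd_square, of r a]
  by (simp_all add: T_a_def matrix_mul_assoc msqrt_psd msqrt_square)

lemma continuous_on_T_a: "continuous_on psd (T_a a)"
  unfolding T_a_def
proof (rule continuous_on_compose2[OF continuous_on_msqrt])
  show "continuous_on psd (\<lambda>r. a ** r ** r ** transpose a)" by (intro continuous_intros)
  show "(\<lambda>r. a ** r ** r ** transpose a) ` psd \<subseteq> psd"
    using psd_congruence[OF psd_square, of _ a] by (auto simp: matrix_mul_assoc)
qed

lemma T_a_inverse:
  fixes a b :: "real^'n^'n"
  assumes "b ** a = mat 1" "r \<in> psd"
  shows "T_a b (T_a a r) = r"
proof -
  have "b ** T_a a r ** T_a a r ** transpose b = b ** (T_a a r ** T_a a r) ** transpose b"
    by (simp only: matrix_mul_assoc)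
  also have "\<dots> = (b ** a) ** r ** r ** transpose (b ** a)"
    by (simp only: T_a_square[OF assms(2)] matrix_transpose_mul matrix_mul_assoc)
  finally show ?thesis unfolding T_a_def[of b] using assms by (simp add: msqrt_of_square)
qed

lemma T_a_hyp_aut:
  fixes a :: "real^'n^'n"
  assumes a: "invertible a" and T: "\<And>r. r \<in> psd \<Longrightarrow> T r = T_a a r"
  shows "hyp_aut \<mu> T"
  unfolding hyp_aut_def
proof (intro conjI ballI)
  let ?b = "matrix_inv a"
  have inv: "?b ** a = mat 1" "a ** ?b = mat 1" using invertible_matrix_inv[OF a] by auto
  have "homeomorphism psd psd T (T_a ?b)"
  proof (rule homeomorphismI)
    show cont: "continuous_on psd T"
      using continuous_on_T_a[of a] T by (simp cong: continuous_on_cong)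
  qed (auto simp: T T_a_psd continuous_on_T_a T_a_inverse[OF inv(1)] T_a_inverse[OF inv(2)])
  then show "\<exists>T'. homeomorphism psd psd T T'" by blast
  have cont: "continuous_on psd T"
    using continuous_on_T_a[of a] T by (simp cong: continuous_on_cong)
  fix x y :: "real^'n^'n" assume x: "x \<in> psd" and y: "y \<in> psd"
  obtain U where U: "orthogonal_matrix U" "a ** x = T_a a x ** U" using psd_polar[OF x a] .
  obtain W where W: "orthogonal_matrix W" "a ** y = T_a a y ** W" using psd_polar[OF y a] .
  let ?X = "T_a a x" and ?Y = "T_a a y" and ?P = "restrict_space borel psd :: (real^'n^'n) measure"
  define g where "g v = W ** v ** transpose U" for v
  note g = base_measure_orthogonal[OF U(1) W(1), folded g_def]
  have XY: "?X \<in> psd" "?Y \<in> psd" by (simp_all add: T_a_psd x y)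
  \<comment> \<open>The orthogonal factors are absorbed into the integration variable: a x = X U and
    a y = Y W turn a (y v x) a^T into Y (W v U^T) X, so T carries \<open>bmap x y\<close> to
    \<open>bmap ?X ?Y\<close> after the substitution g, which preserves the base measure.\<close>
  have Tb: "T (bmap x y v) = bmap ?X ?Y (g v)" if "v \<in> ballD" for v
  proof -
    have v: "v \<in> contractions" using that ballD_subset_contractions by blast
    have mp: "mixture x y v \<in> psd" by (intro mixture_psd psd_symmetric x y v)
    have 1: "a ** (x ** x) ** transpose a = ?X ** ?X" "a ** (y ** y) ** transpose a = ?Y ** ?Y"
      by (simp_all add: T_a_square x y matrix_mul_assoc)
    have tx: "x ** transpose a = transpose U ** ?X" and ty: "y ** transpose a = transpose W ** ?Y"
      using arg_cong[OF U(2), of transpose] arg_cong[OF W(2), of transpose]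
      by (simp_all add: matrix_transpose_mul psd_symmetric x y XY)
    have "a ** (y ** v ** x) ** transpose a = (a ** y) ** v ** (x ** transpose a)"
      by (simp only: matrix_mul_assoc)
    also have "\<dots> = ?Y ** g v ** ?X" by (simp only: W(2) tx g_def matrix_mul_assoc)
    finally have 2: "a ** (y ** v ** x) ** transpose a = ?Y ** g v ** ?X" .
    have "a ** (x ** transpose v ** y) ** transpose a = (a ** x) ** transpose v ** (y ** transpose a)"
      by (simp only: matrix_mul_assoc)
    also have "\<dots> = ?X ** transpose (g v) ** ?Y"
      by (simp only: U(2) ty g_def matrix_transpose_mul transpose_transpose matrix_mul_assoc)
    finally have 3: "a ** (x ** transpose v ** y) ** transpose a = ?X ** transpose (g v) ** ?Y" .
    have "a ** mixture x y v ** transpose a = mixture ?X ?Y (g v)"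
      unfolding mixture_def matrix_add_ldistrib matrix_add_rdistrib 1 2 3 ..
    then have "T_a a (msqrt (mixture x y v)) = msqrt (mixture ?X ?Y (g v))"
      unfolding T_a_def by (metis matrix_mul_assoc mp msqrt_square)
    then show ?thesis using T[OF msqrt_psd[OF mp]] by (simp add: bmap_def)
  qed
  have Tm: "T \<in> ?P \<rightarrow>\<^sub>M ?P"
    by (rule measurable_psd_continuous[OF cont]) (auto simp: T T_a_psd)
  have "distr (bconv \<mu> x y) ?P T = distr (base_measure \<mu>) ?P (T \<circ> bmap x y)"
    unfolding bconv_eq by (rule distr_distr[OF Tm measurable_bmap[OF x y]])
  also have "\<dots> = distr (base_measure \<mu>) ?P (bmap ?X ?Y \<circ> g)"
    by (rule distr_cong) (auto simp: space_base_measure Tb)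
  also have "\<dots> = distr (distr (base_measure \<mu>) (base_measure \<mu>) g) ?P (bmap ?X ?Y)"
    by (rule distr_distr[OF measurable_bmap[OF XY] g(1), symmetric])
  also have "\<dots> = bconv \<mu> (T x) (T y)" by (simp add: g(2) bconv_eq T x y)
  finally show "distr (bconv \<mu> x y) ?P T = bconv \<mu> (T x) (T y)" .
qed

theorem mainTheorem1:
  fixes \<mu> :: real and T :: "real^'n^'n \<Rightarrow> real^'n^'n"
  assumes "\<mu> > rho_of TYPE('n) - 1"
  shows "hyp_aut \<mu> T \<longleftrightarrow> (\<exists>a::real^'n^'n. invertible a \<and> (\<forall>r\<in>psd. T r = T_a a r))"
  using hyp_aut_imp_congruence[OF assms] T_a_hyp_aut by blast

end
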